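(* Let $J:\mathbb{R}^N\setminus\{0\}\to[0,\infty)$ be radially symmetric, positive near the origin, and such that $\int_{\mathbb{R}^N}J(z)\min\{|z|^2,1\}\,dz<\infty$. Assume that for some $0<\alpha\le2$ there exist $c_0,R>0$ with $J(z)\ge c_0|z|^{-N-\alpha}$ for $|z|\ge R$. Let $u_0\in L^1(\mathbb{R}^N)\cap L^\infty(\mathbb{R}^N)$ and let $u$ be the associated solution of $$\partial_tu+\mathcal{L}u=0\ \text{ in }\mathbb{R}^N\times(0,\infty),\qquad u(\cdot,0)=u_0 .$$ Then $$\lim_{t\to\infty}\|u(t)\|_\infty=0 .$$
   Context: $N\ge1$ is an integer. The operator is $\mathcal{L}f(x)=\mathrm{P.V.}\int_{\mathbb{R}^N}(f(x)-f(y))J(x-y)\,dy$, with multiplier $m(\xi)=\int_{\mathbb{R}^N}(1-\cos(z\cdot\xi))J(z)\,dz$. For $u_0\in L^1(\mathbb{R}^N)\cap L^2(\mathbb{R}^N)$ "the solution" is the (unique) weak solution, given by $u(t)=u_0*\mu_t$, where $\mu_t$ is the probability measure on $\mathbb{R}^N$ with $\widehat{\mu_t}(\xi)=e^{-m(\xi)t}$. *)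

theory Defs
  imports "HOL-Analysis.Analysis" "HOL-Probability.Probability"
begin

text \<open>
  Throughout, \<open>'a :: euclidean_space\<close> plays the role of \<open>R^N\<close> with \<open>N = DIM('a) \<ge> 1\<close>.
  A kernel \<open>J\<close> on \<open>R^N - {0}\<close> is a total function whose value at \<open>0\<close> is irrelevant:
  the pointwise conditions skip the origin, and the integrals do not see it.
\<close>

definition radially_symmetric :: "('a::euclidean_space \<Rightarrow> real) \<Rightarrow> bool" where
  "radially_symmetric J \<longleftrightarrow> (\<forall>x y. x \<noteq> 0 \<and> y \<noteq> 0 \<and> norm x = norm y \<longrightarrow> J x = J y)"

definition positive_near_origin :: "('a::euclidean_space \<Rightarrow> real) \<Rightarrow> bool" where
  "positive_near_origin J \<longleftrightarrow> (\<exists>\<delta>>0. \<forall>z. 0 < norm z \<and> norm z < \<delta> \<longrightarrow> J z > 0)"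

definition levy_kernel :: "('a::euclidean_space \<Rightarrow> real) \<Rightarrow> bool" where
  "levy_kernel J \<longleftrightarrow>
     (\<forall>z. z \<noteq> 0 \<longrightarrow> 0 \<le> J z) \<and> radially_symmetric J \<and> positive_near_origin J \<and>
     integrable lebesgue (\<lambda>z. J z * min ((norm z)\<^sup>2) 1)"

definition multiplier :: "('a::euclidean_space \<Rightarrow> real) \<Rightarrow> 'a \<Rightarrow> real" where
  "multiplier J \<xi> = (LINT z|lebesgue. (1 - cos (z \<bullet> \<xi>)) * J z)"

definition fourier_measure :: "'a::euclidean_space measure \<Rightarrow> 'a \<Rightarrow> complex" where
  "fourier_measure \<mu> \<xi> = (LINT y|\<mu>. cis (- (y \<bullet> \<xi>)))"

text \<open>\<open>heat_measure J t \<mu>\<close>: \<open>\<mu>\<close> is the fundamental solution \<open>\<mu>\<^sub>t\<close>. It exists by the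
  Levy-Khintchine theorem and is unique because the Fourier transform is injective.\<close>

definition heat_measure :: "('a::euclidean_space \<Rightarrow> real) \<Rightarrow> real \<Rightarrow> 'a measure \<Rightarrow> bool" where
  "heat_measure J t \<mu> \<longleftrightarrow>
     prob_space \<mu> \<and> sets \<mu> = sets borel \<and>
     (\<forall>\<xi>. fourier_measure \<mu> \<xi> = complex_of_real (exp (- multiplier J \<xi> * t)))"

text \<open>The completion matters: for a Lebesgue (not Borel) measurable \<open>f\<close>, almost every translate
  \<open>y \<mapsto> f (x - y)\<close> is measurable only with respect to the completion of \<open>\<mu>\<close>.\<close>

definition convolution_measure ::
    "('a::euclidean_space \<Rightarrow> real) \<Rightarrow> 'a measure \<Rightarrow> 'a \<Rightarrow> real" where
  "convolution_measure f \<mu> x = (LINT y|completion \<mu>. f (x - y))"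

text \<open>The weak solution of \<open>\<partial>\<^sub>t u + L u = 0\<close>, \<open>u(0) = u0\<close>, for
  \<open>L f(x) = P.V. \<integral> (f x - f y) J (x - y) dy\<close>, the operator with Fourier symbol \<open>multiplier J\<close>,
  in its representation \<open>u(t) = u0 * \<mu>\<^sub>t\<close>.
  Each \<open>u t\<close> is an almost-everywhere class, given by an arbitrary member.\<close>

definition nonlocal_heat_solution ::
    "('a::euclidean_space \<Rightarrow> real) \<Rightarrow> ('a \<Rightarrow> real) \<Rightarrow> (real \<Rightarrow> 'a \<Rightarrow> real) \<Rightarrow> bool" where
  "nonlocal_heat_solution J u0 u \<longleftrightarrow>
     (\<exists>\<mu>. \<forall>t\<ge>0. heat_measure J t (\<mu> t) \<and> u t \<in> borel_measurable lebesgue \<and>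
        (AE x in lebesgue. u t x = convolution_measure u0 (\<mu> t) x))"

definition Linf_norm :: "('a::euclidean_space \<Rightarrow> real) \<Rightarrow> ereal" where
  "Linf_norm f = esssup lebesgue (\<lambda>x. ereal \<bar>f x\<bar>)"

end

theory Submission
  imports Defs "HOL-Real_Asymp.Real_Asymp"
begin

text \<open>
  Minorise the kernel by \<open>k = c 1\<^bsub>R \<le> |z| \<le> 2R\<^esub>\<close> and write \<open>J = k + K\<close>, so that
  \<open>m = (\<Lambda> - C) + m\<^sub>K\<close> with \<open>\<Lambda> = \<integral>k\<close> and \<open>C\<close> the Fourier transform of \<open>k\<close>. In
  \<open>exp (- t (\<Lambda> - C)) = exp (- t \<Lambda>) (1 + t C) + r\<^sub>t\<close> the first term corresponds to a measure of
  mass at most \<open>exp (- t \<Lambda>) (1 + t \<Lambda>)\<close>, while \<open>|r\<^sub>t| \<le> 8 C\<^sup>2 / \<Lambda>\<^sup>2\<close> is dominated by an integrable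
  function, because \<open>k \<in> L\<^sup>2\<close>, and tends to \<open>0\<close> off the origin; so \<open>r\<^sub>t\<close> tends to \<open>0\<close> in \<open>L\<^sup>1\<close>.
  The factor \<open>exp (- t m\<^sub>K)\<close> is harmless: it is the limit of the symbols of the compound Poisson
  semigroups obtained by cutting off \<open>K\<close> near \<open>0\<close>, and these contract \<open>L\<^sup>\<infinity>\<close>. Fourier inversion is only
  used in Gaussian-regularised form, so that no integrability of \<open>exp (- t m)\<close> is needed.
\<close>

section \<open>Gaussians and their Fourier transform\<close>

text \<open>The obstacle is the absence of smoothing. If \<open>J\<close> is integrable, then
  \<mu>_t has an atom at 0 and u(t) always contains a multiple of \<open>u0\<close>, so u(t) cannot
  be bounded by the L^1 norm of \<open>u0\<close> alone. Both norms are used: the sup norm pays for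
  the terms of order 0 and 1 in C, which are convolutions by a Dirac mass and by \<open>k\<close>,
  and the L^1 norm pays for r_t, because it bounds the transform of \<open>u0\<close>. The expansion
  has to reach order 1. Since \<open>k\<close> jumps at the edges of the annulus, C is not
  integrable, and integrating the linear term over the frequencies would fail; from order 2 on,
  integrability of C^2 takes over. The annulus is bounded and stays away from 0, so the tail bound
  dominates a single positive constant there, and \<open>k\<close> is bounded with finite positive
  mass. All Gaussian-regularised estimates are uniform in \<epsilon>. This uniformity is what allows
  the return to an almost-everywhere bound at the end, by testing against compact sets.\<close>

lemma lborel_integral_affine:
  fixes f :: "'a::euclidean_space \<Rightarrow> 'b::{banach, second_countable_topology}"
  assumes [measurable]: "f \<in> borel_measurable borel" and c: "c \<noteq> 0"
  shows "(LINT x|lborel. f x) = \<bar>c\<bar> ^ DIM('a) *\<^sub>R (LINT x|lborel. f (t + c *\<^sub>R x))"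
  by (subst lborel_affine[OF c, of t]) (simp add: integral_density integral_distr)

lemma lborel_integrable_affine_iff:
  fixes f :: "'a::euclidean_space \<Rightarrow> 'b::{banach, second_countable_topology}"
  assumes [measurable]: "f \<in> borel_measurable borel" and c: "c \<noteq> 0"
  shows "integrable lborel (\<lambda>x. f (t + c *\<^sub>R x)) \<longleftrightarrow> integrable lborel f"
proof -
  have "integrable lborel f \<longleftrightarrow> integrable lborel (\<lambda>x. (\<bar>c\<bar> ^ DIM('a)) *\<^sub>R f (t + c *\<^sub>R x))"
    by (subst lborel_affine[OF c, of t]) (simp add: integrable_density integrable_distr_eq)
  also have "\<dots> \<longleftrightarrow> integrable lborel (\<lambda>x. f (t + c *\<^sub>R x))"
    using integrable_scaleR_right[of "inverse (\<bar>c\<bar> ^ DIM('a))" lborel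
        "\<lambda>x. (\<bar>c\<bar> ^ DIM('a)) *\<^sub>R f (t + c *\<^sub>R x)"] c
    by auto
  finally show ?thesis ..
qed

lemma lborel_AE_affine:
  fixes P :: "'a::euclidean_space \<Rightarrow> bool"
  assumes "AE x in lborel. P x" and c: "c \<noteq> 0"
  shows "AE x in lborel. P (t + c *\<^sub>R x)"
proof -
  have "AE x in density (distr lborel borel (\<lambda>x. t + c *\<^sub>R x)) (\<lambda>_. \<bar>c\<bar> ^ DIM('a)). P x"
    by (subst lborel_affine[OF c, of t, symmetric]) (rule assms)
  then have "AE x in distr lborel borel (\<lambda>x. t + c *\<^sub>R x). P x"
    using c by (subst (asm) AE_density) auto
  then show ?thesis
    by (rule AE_distrD[rotated]) simp
qed

lemma lborel_integral_translate:
  fixes f :: "'a::euclidean_space \<Rightarrow> 'b::{banach, second_countable_topology}"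
  assumes "f \<in> borel_measurable borel"
  shows "(LINT x|lborel. f (x - t)) = (LINT x|lborel. f x)"
  using lborel_integral_affine[OF assms, of 1 "- t"] by (simp add: algebra_simps)

lemma lborel_integrable_translate_iff:
  fixes f :: "'a::euclidean_space \<Rightarrow> 'b::{banach, second_countable_topology}"
  assumes "f \<in> borel_measurable borel"
  shows "integrable lborel (\<lambda>x. f (x - t)) \<longleftrightarrow> integrable lborel f"
  using lborel_integrable_affine_iff[OF assms, of 1 "- t"] by (simp add: algebra_simps)

lemma lborel_integral_reflect:
  fixes f :: "'a::euclidean_space \<Rightarrow> 'b::{banach, second_countable_topology}"
  assumes "f \<in> borel_measurable borel"
  shows "(LINT x|lborel. f (- x)) = (LINT x|lborel. f x)"
  using lborel_integral_affine[OF assms, of "-1" 0] by simp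

lemma lborel_integrable_reflect_iff:
  fixes f :: "'a::euclidean_space \<Rightarrow> 'b::{banach, second_countable_topology}"
  assumes "f \<in> borel_measurable borel"
  shows "integrable lborel (\<lambda>x. f (- x)) \<longleftrightarrow> integrable lborel f"
  using lborel_integrable_affine_iff[OF assms, of "-1" 0] by simp

lemma borel_measurable_cis [measurable (raw)]:
  "f \<in> borel_measurable M \<Longrightarrow> (\<lambda>x. cis (f x)) \<in> borel_measurable M"
  unfolding cis_conv_exp by measurable

section \<open>The Gaussian transform, on the line and then on the whole space\<close>

lemma gaussian_fourier_real:
  fixes s \<epsilon> :: real
  assumes "0 < \<epsilon>"
  shows "integrable lborel (\<lambda>x. complex_of_real (exp (- \<epsilon> * x\<^sup>2 / 2)) * cis (s * x))" (is ?I)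
    and "(LINT x|lborel. complex_of_real (exp (- \<epsilon> * x\<^sup>2 / 2)) * cis (s * x)) =
           complex_of_real (sqrt (2 * pi / \<epsilon>) * exp (- s\<^sup>2 / (2 * \<epsilon>)))" (is ?E)
proof -
  let ?f = "\<lambda>x. complex_of_real (exp (- \<epsilon> * x\<^sup>2 / 2)) * cis (s * x)"
  \<comment> \<open>Rescaling by \<open>c\<close> turns the integrand into a multiple of the
    standard normal density times a character, so the value is the characteristic function of the
    normal law.\<close>
  define c where "c = 1 / sqrt \<epsilon>"
  have c: "c > 0" "c\<^sup>2 = 1 / \<epsilon>" using assms by (auto simp: c_def power_divide)
  have fc: "?f (0 + c *\<^sub>R x) = complex_of_real (sqrt (2 * pi)) * (std_normal_density x *\<^sub>R iexp (s * c * x))" for x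
    using assms c
    by (simp add: std_normal_density_def cis_conv_exp scaleR_conv_of_real power_mult_distrib mult_ac)
  have int: "integrable lborel (\<lambda>x. std_normal_density x *\<^sub>R iexp (s * c * x))"
    by (rule Bochner_Integration.integrable_bound[OF integrable_std_normal_moment[of 0]])
       (auto simp: normal_density_nonneg)
  have m: "?f \<in> borel_measurable borel" by measurable
  show ?I
    using c by (subst lborel_integrable_affine_iff[OF m, of c 0, symmetric]) (auto simp only: fc int intro!: integrable_mult_right)
  have ch: "(LINT x|lborel. std_normal_density x *\<^sub>R iexp (s * c * x)) = exp (- (s * c)\<^sup>2 / 2)"
    using fun_cong[OF char_std_normal_distribution, of "s * c"]
    unfolding char_def by (subst (asm) integral_density) (auto simp: normal_density_nonneg)
  have "(LINT x|lborel. ?f x) = c * (sqrt (2 * pi) * exp (- (s * c)\<^sup>2 / 2))"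
    using c by (subst lborel_integral_affine[OF m, of c 0]) (simp_all only: fc integral_mult_right_zero ch, simp add: scaleR_conv_of_real)
  also have "c * (sqrt (2 * pi) * exp (- (s * c)\<^sup>2 / 2)) = sqrt (2 * pi / \<epsilon>) * exp (- s\<^sup>2 / (2 * \<epsilon>))"
    using c by (simp add: power_mult_distrib c_def real_sqrt_divide field_simps)
  finally show ?E .
qed

text \<open>Lebesgue measure is the image of a product of one-dimensional Lebesgue measures under
  the coordinate map, so Fubini for finite products applies. This is what carries the Gaussian
  transform from the line to the whole space.\<close>

lemma integrable_lborel_prod_Basis:
  fixes f :: "'a::euclidean_space \<Rightarrow> real \<Rightarrow> complex"
  assumes "\<And>b. b \<in> Basis \<Longrightarrow> integrable lborel (f b)"
  shows "integrable lborel (\<lambda>x::'a. \<Prod>b\<in>Basis. f b (x \<bullet> b))"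
    and "(LINT x|lborel. (\<Prod>b\<in>Basis. f b ((x::'a) \<bullet> b))) = (\<Prod>b\<in>Basis. (LINT x|lborel. f b x))"
proof -
  interpret product_sigma_finite "\<lambda>_::'a. lborel :: real measure" ..
  have [measurable]: "b \<in> Basis \<Longrightarrow> f b \<in> borel_measurable borel" for b
    using borel_measurable_integrable[OF assms] by simp
  have e: "(\<Prod>b\<in>Basis. f b ((\<Sum>b\<in>Basis. x b *\<^sub>R b) \<bullet> b)) = (\<Prod>b\<in>Basis. f b (x b))" for x :: "'a \<Rightarrow> real"
    by (intro prod.cong) (auto simp: inner_sum_left inner_Basis if_distrib cong: if_cong)
  show "integrable lborel (\<lambda>x::'a. \<Prod>b\<in>Basis. f b (x \<bullet> b))"
    by (subst lborel_eq, subst integrable_distr_eq)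
       (auto simp: e intro!: product_integrable_prod assms)
  show "(LINT x|lborel. (\<Prod>b\<in>Basis. f b ((x::'a) \<bullet> b))) = (\<Prod>b\<in>Basis. (LINT x|lborel. f b x))"
    by (subst lborel_eq, subst integral_distr)
       (auto simp: e intro!: product_integral_prod assms)
qed

text \<open>\<open>gauss_kernel \<epsilon>\<close> is the unnormalised Fourier transform of \<open>gauss_weight \<epsilon>\<close>: its mass is \<open>(2\<pi>)\<^sup>N\<close>.\<close>

definition gauss_weight :: "real \<Rightarrow> 'a::euclidean_space \<Rightarrow> real" where
  "gauss_weight \<epsilon> \<xi> = exp (- \<epsilon> * (norm \<xi>)\<^sup>2 / 2)"

definition gauss_kernel :: "real \<Rightarrow> 'a::euclidean_space \<Rightarrow> real" where
  "gauss_kernel \<epsilon> v = sqrt (2 * pi / \<epsilon>) ^ DIM('a) * exp (- (norm v)\<^sup>2 / (2 * \<epsilon>))"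

lemma gauss_weight_measurable [measurable]: "gauss_weight \<epsilon> \<in> borel_measurable borel"
  unfolding gauss_weight_def[abs_def] by measurable

lemma gauss_kernel_measurable [measurable]: "gauss_kernel \<epsilon> \<in> borel_measurable borel"
  unfolding gauss_kernel_def[abs_def] by measurable

lemma gauss_kernel_nonneg: "0 < \<epsilon> \<Longrightarrow> 0 \<le> gauss_kernel \<epsilon> v"
  by (simp add: gauss_kernel_def)

lemma norm_power2_eq_sum_Basis: "(norm x)\<^sup>2 = (\<Sum>b\<in>Basis. (x \<bullet> b)\<^sup>2)"
  unfolding power2_norm_eq_inner by (subst euclidean_inner) (simp add: power2_eq_square)

lemma cis_sum: "finite A \<Longrightarrow> cis (sum f A) = (\<Prod>a\<in>A. cis (f a))"
  by (induction A rule: finite_induct) (simp_all add: cis_mult[symmetric])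

lemma gaussian_fourier:
  fixes v :: "'a::euclidean_space"
  assumes "0 < \<epsilon>"
  shows "integrable lborel (\<lambda>\<xi>. complex_of_real (gauss_weight \<epsilon> \<xi>) * cis (v \<bullet> \<xi>))"
    and "(LINT \<xi>|lborel. complex_of_real (gauss_weight \<epsilon> \<xi>) * cis (v \<bullet> \<xi>)) = complex_of_real (gauss_kernel \<epsilon> v)"
proof -
  have eq: "complex_of_real (gauss_weight \<epsilon> \<xi>) * cis (v \<bullet> \<xi>) =
      (\<Prod>b\<in>Basis. complex_of_real (exp (- \<epsilon> * (\<xi> \<bullet> b)\<^sup>2 / 2)) * cis ((v \<bullet> b) * (\<xi> \<bullet> b)))" for \<xi>
    by (simp add: gauss_weight_def norm_power2_eq_sum_Basis euclidean_inner[of v \<xi>] cis_sum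
        prod.distrib exp_sum[symmetric] sum_distrib_left sum_divide_distrib sum_negf flip: of_real_prod)
  show "integrable lborel (\<lambda>\<xi>. complex_of_real (gauss_weight \<epsilon> \<xi>) * cis (v \<bullet> \<xi>))"
    unfolding eq by (intro integrable_lborel_prod_Basis gaussian_fourier_real assms)
  have "(LINT \<xi>|lborel. complex_of_real (gauss_weight \<epsilon> \<xi>) * cis (v \<bullet> \<xi>)) =
      (\<Prod>b\<in>Basis. complex_of_real (sqrt (2 * pi / \<epsilon>) * exp (- (v \<bullet> b)\<^sup>2 / (2 * \<epsilon>))))"
    unfolding eq
    by (subst integrable_lborel_prod_Basis(2)) (simp_all only: gaussian_fourier_real[OF assms])
  also have "\<dots> = complex_of_real (gauss_kernel \<epsilon> v)"
    by (simp add: gauss_kernel_def norm_power2_eq_sum_Basis prod.distrib exp_sum[symmetric] sum_divide_distrib sum_negf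
        flip: of_real_prod of_real_mult of_real_power)
  finally show "(LINT \<xi>|lborel. complex_of_real (gauss_weight \<epsilon> \<xi>) * cis (v \<bullet> \<xi>)) = complex_of_real (gauss_kernel \<epsilon> v)" .
qed

lemma gauss_weight_integrable: "0 < \<epsilon> \<Longrightarrow> integrable lborel (gauss_weight \<epsilon>)"
  using integrable_norm[OF gaussian_fourier(1)[of \<epsilon> 0]] by (simp add: gauss_weight_def[abs_def])

text \<open>Up to a constant the kernel is the weight with parameter 1/\<epsilon>, so its mass is a
  Gaussian transform read at frequency 0; the powers of \<epsilon> then cancel.\<close>

lemma gauss_kernel_integral:
  assumes "0 < \<epsilon>"
  shows "integrable lborel (gauss_kernel \<epsilon> :: 'a::euclidean_space \<Rightarrow> real)"
    and "(LINT v|lborel. gauss_kernel \<epsilon> (v :: 'a)) = (2 * pi) ^ DIM('a)"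
proof -
  have k: "gauss_kernel \<epsilon> v = sqrt (2 * pi / \<epsilon>) ^ DIM('a) * gauss_weight (1 / \<epsilon>) v" for v :: 'a
    by (simp add: gauss_kernel_def gauss_weight_def)
  show "integrable lborel (gauss_kernel \<epsilon> :: 'a \<Rightarrow> real)"
    unfolding k using assms by (intro integrable_mult_right gauss_weight_integrable) auto
  have "complex_of_real (LINT v|lborel. gauss_weight (1 / \<epsilon>) (v::'a)) = complex_of_real (gauss_kernel (1 / \<epsilon>) (0::'a))"
    using gaussian_fourier(2)[of "1 / \<epsilon>" "0 :: 'a"] assms by (simp add: integral_complex_of_real)
  then have w: "(LINT v|lborel. gauss_weight (1 / \<epsilon>) (v::'a)) = gauss_kernel (1 / \<epsilon>) (0::'a)"
    by (rule of_real_eq_iff[THEN iffD1])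
  have "(LINT v|lborel. gauss_kernel \<epsilon> (v :: 'a)) = (sqrt (2 * pi / \<epsilon>) * sqrt (2 * pi * \<epsilon>)) ^ DIM('a)"
    unfolding k integral_mult_right_zero w by (simp only: gauss_kernel_def power_mult_distrib) simp
  also have "sqrt (2 * pi / \<epsilon>) * sqrt (2 * pi * \<epsilon>) = 2 * pi"
    using assms by (simp add: real_sqrt_mult[symmetric] real_sqrt_mult_self power2_eq_square[symmetric] real_sqrt_unique)
  finally show "(LINT v|lborel. gauss_kernel \<epsilon> (v :: 'a)) = (2 * pi) ^ DIM('a)" .
qed

text \<open>Sign and normalisation agree with \<open>fourier_measure\<close>, so that convolution by
  a measure multiplies transforms without a constant. The price is a factor
  \<open>(2 * pi) ^ DIM('a)\<close> in every inversion estimate.\<close>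

definition fourier :: "('a::euclidean_space \<Rightarrow> real) \<Rightarrow> 'a \<Rightarrow> complex" where
  "fourier w \<xi> = (LINT y|lborel. complex_of_real (w y) * cis (- (y \<bullet> \<xi>)))"

text \<open>Supplies the hypothesis of Fubini for the double integrals below, where the third factor
  is a character or a Gaussian kernel divided by its maximum.\<close>

lemma integrable_product_bounded:
  fixes f :: "'a \<Rightarrow> 'c::{real_normed_field, banach, second_countable_topology}" and g :: "'b \<Rightarrow> 'c"
  assumes M: "sigma_finite_measure M" and N: "sigma_finite_measure N"
    and f [measurable]: "integrable M f" and g [measurable]: "integrable N g"
    and k [measurable]: "k \<in> borel_measurable (M \<Otimes>\<^sub>M N)" and b: "\<And>p. norm (k p) \<le> 1"
  shows "integrable (M \<Otimes>\<^sub>M N) (\<lambda>(x, y). f x * g y * k (x, y))"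
proof -
  interpret M: sigma_finite_measure M by (rule M)
  interpret N: sigma_finite_measure N by (rule N)
  interpret pair_sigma_finite M N ..
  have "integrable (M \<Otimes>\<^sub>M N) (\<lambda>(x, y). f x * g y)"
    by (rule Fubini_integrable) (simp_all add: norm_mult f g integrable_norm)
  then show ?thesis
    by (rule Bochner_Integration.integrable_bound)
       (auto simp: norm_mult intro!: AE_I2 mult_left_le b)
qed

section \<open>Gaussian-regularised Fourier inversion and convolution\<close>

lemma cis_inner_diff: "cis (- (y \<bullet> \<xi>)) * cis (x \<bullet> \<xi>) = cis ((x - y) \<bullet> \<xi>)"
  by (simp add: cis_mult inner_diff_left)

lemma fourier_measurable [measurable]:
  assumes [measurable]: "w \<in> borel_measurable borel"
  shows "fourier w \<in> borel_measurable borel"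
  unfolding fourier_def[abs_def] by measurable

lemma fourier_norm_le:
  assumes [measurable]: "integrable lborel w"
  shows "norm (fourier w \<xi>) \<le> (LINT y|lborel. \<bar>w y\<bar>)"
  unfolding fourier_def by (rule order_trans[OF integral_norm_bound]) (simp add: norm_mult)

lemma fourier_measure_measurable:
  assumes "sigma_finite_measure \<nu>" and [measurable_cong]: "sets \<nu> = sets borel"
  shows "fourier_measure \<nu> \<in> borel_measurable borel"
proof -
  interpret sigma_finite_measure \<nu> by fact
  show ?thesis unfolding fourier_measure_def[abs_def] by measurable
qed

lemma fourier_measure_norm_le:
  assumes "finite_measure \<nu>"
  shows "norm (fourier_measure \<nu> \<xi>) \<le> measure \<nu> (space \<nu>)"
  unfolding fourier_measure_def by (rule order_trans[OF integral_norm_bound]) simp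

text \<open>The Fourier inversion integral at \<open>x\<close>, without its constant and damped by a
  Gaussian; the damping makes it converge absolutely for every bounded measurable
  \<open>F\<close>.\<close>

definition gauss_pairing :: "real \<Rightarrow> 'a::euclidean_space \<Rightarrow> ('a \<Rightarrow> complex) \<Rightarrow> complex" where
  "gauss_pairing \<epsilon> x F = (LINT \<xi>|lborel. F \<xi> * (complex_of_real (gauss_weight \<epsilon> \<xi>) * cis (x \<bullet> \<xi>)))"

lemma norm_gauss_weight_cis_le: "0 \<le> \<epsilon> \<Longrightarrow> norm (complex_of_real (gauss_weight \<epsilon> \<xi>) * cis s) \<le> 1"
  by (simp add: norm_mult gauss_weight_def)

lemma gauss_pairing_integrable:
  fixes F :: "'a::euclidean_space \<Rightarrow> complex"
  assumes \<epsilon>: "0 < \<epsilon>" and [measurable]: "F \<in> borel_measurable borel" and b: "\<And>\<xi>. norm (F \<xi>) \<le> B"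
  shows "integrable lborel (\<lambda>\<xi>. F \<xi> * (complex_of_real (gauss_weight \<epsilon> \<xi>) * cis (x \<bullet> \<xi>)))"
proof (rule Bochner_Integration.integrable_bound)
  show "integrable lborel (\<lambda>\<xi>::'a. B * gauss_weight \<epsilon> \<xi>)"
    by (intro integrable_mult_right gauss_weight_integrable \<epsilon>)
  show "AE \<xi> in lborel. norm (F \<xi> * (complex_of_real (gauss_weight \<epsilon> \<xi>) * cis (x \<bullet> \<xi>))) \<le> norm (B * gauss_weight \<epsilon> \<xi>)"
    using order_trans[OF norm_ge_zero b]
    by (auto simp: norm_mult gauss_weight_def intro!: mult_right_mono b AE_I2)
qed measurable

text \<open>The Gaussian weight is the dominating function, so bounded pointwise convergence of
  symbols is enough. It serves twice: to sum an exponential series and to remove a cut-off of the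
  kernel.\<close>

lemma gauss_pairing_tendsto:
  fixes F :: "nat \<Rightarrow> 'a::euclidean_space \<Rightarrow> complex"
  assumes \<epsilon>: "0 < \<epsilon>" and m: "\<And>n. F n \<in> borel_measurable borel"
    and b: "\<And>n \<xi>. norm (F n \<xi>) \<le> B" and lim: "\<And>\<xi>. (\<lambda>n. F n \<xi>) \<longlonglongrightarrow> F' \<xi>"
  shows "(\<lambda>n. gauss_pairing \<epsilon> x (F n)) \<longlonglongrightarrow> gauss_pairing \<epsilon> x F'"
  unfolding gauss_pairing_def
proof (rule integral_dominated_convergence[where w = "\<lambda>\<xi>. B * gauss_weight \<epsilon> \<xi>"])
  have [measurable]: "F' \<in> borel_measurable borel"
    by (rule borel_measurable_LIMSEQ_metric[OF m lim])
  note m [measurable]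
  show "(\<lambda>\<xi>. F' \<xi> * (complex_of_real (gauss_weight \<epsilon> \<xi>) * cis (x \<bullet> \<xi>))) \<in> borel_measurable lborel"
    by measurable
  show "(\<lambda>\<xi>. F n \<xi> * (complex_of_real (gauss_weight \<epsilon> \<xi>) * cis (x \<bullet> \<xi>))) \<in> borel_measurable lborel" for n
    by measurable
  show "integrable lborel (\<lambda>\<xi>::'a. B * gauss_weight \<epsilon> \<xi>)"
    by (intro integrable_mult_right gauss_weight_integrable \<epsilon>)
  show "AE \<xi> in lborel. (\<lambda>n. F n \<xi> * (complex_of_real (gauss_weight \<epsilon> \<xi>) * cis (x \<bullet> \<xi>)))
      \<longlonglongrightarrow> F' \<xi> * (complex_of_real (gauss_weight \<epsilon> \<xi>) * cis (x \<bullet> \<xi>))"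
    by (intro AE_I2 tendsto_intros lim)
  show "AE \<xi> in lborel. norm (F n \<xi> * (complex_of_real (gauss_weight \<epsilon> \<xi>) * cis (x \<bullet> \<xi>))) \<le> B * gauss_weight \<epsilon> \<xi>" for n
    by (auto simp: norm_mult gauss_weight_def intro!: mult_right_mono b AE_I2)
qed

text \<open>The damped character has modulus at most 1, whatever \<epsilon> is. Through this bound a
  symbol that is small in L^1 gives a uniformly small contribution.\<close>

lemma gauss_pairing_norm_le:
  assumes \<epsilon>: "0 \<le> \<epsilon>" and F: "integrable lborel F"
  shows "norm (gauss_pairing \<epsilon> x F) \<le> (LINT \<xi>|lborel. norm (F \<xi>))"
proof -
  have "norm (F \<xi> * (complex_of_real (gauss_weight \<epsilon> \<xi>) * cis (x \<bullet> \<xi>))) \<le> norm (F \<xi>)" for \<xi>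
    unfolding norm_mult[of "F \<xi>"] by (intro mult_left_le norm_gauss_weight_cis_le \<epsilon> norm_ge_zero)
  then show ?thesis
    unfolding gauss_pairing_def
    by (intro order_trans[OF integral_norm_bound] integral_mono' integrable_norm F) auto
qed

text \<open>Fubini lets the Gaussian transform act on the damped character, which leaves an average
  of \<open>w\<close> against the Gaussian kernel centred at \<open>x\<close>. This replaces Fourier
  inversion throughout.\<close>

lemma gauss_pairing_fourier:
  fixes w :: "'a::euclidean_space \<Rightarrow> real"
  assumes \<epsilon>: "0 < \<epsilon>" and w: "integrable lborel w"
  shows "gauss_pairing \<epsilon> x (fourier w) = complex_of_real (LINT y|lborel. w y * gauss_kernel \<epsilon> (x - y))"
proof -
  have [measurable]: "w \<in> borel_measurable borel" using w by auto
  let ?f = "\<lambda>y \<xi>. complex_of_real (w y) * complex_of_real (gauss_weight \<epsilon> \<xi>) * cis ((x - y) \<bullet> \<xi>)"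
  have int: "integrable (lborel \<Otimes>\<^sub>M lborel) (\<lambda>(y, \<xi>). ?f y \<xi>)"
    using integrable_product_bounded[where k = "\<lambda>(y, \<xi>). cis ((x - y) \<bullet> \<xi>)" and
        f = "\<lambda>y. complex_of_real (w y)" and g = "\<lambda>\<xi>. complex_of_real (gauss_weight \<epsilon> \<xi>)" and M = lborel and N = lborel]
      w gauss_weight_integrable[OF \<epsilon>]
    by (auto simp: split_beta sigma_finite_lborel)
  have "gauss_pairing \<epsilon> x (fourier w) = (LINT \<xi>|lborel. (LINT y|lborel. ?f y \<xi>))"
    unfolding gauss_pairing_def fourier_def
    by (intro Bochner_Integration.integral_cong refl, subst integral_mult_left_zero[symmetric],
        intro Bochner_Integration.integral_cong refl) (simp add: cis_inner_diff[symmetric] mult_ac)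
  also have "\<dots> = (LINT y|lborel. (LINT \<xi>|lborel. ?f y \<xi>))"
    by (rule lborel_pair.Fubini_integral) (rule int)
  also have "\<dots> = (LINT y|lborel. complex_of_real (w y) * complex_of_real (gauss_kernel \<epsilon> (x - y)))"
    by (simp add: mult.assoc gaussian_fourier(2)[OF \<epsilon>])
  also have "\<dots> = complex_of_real (LINT y|lborel. w y * gauss_kernel \<epsilon> (x - y))"
    by (simp flip: integral_complex_of_real)
  finally show ?thesis .
qed

text \<open>The averaging kernel is nonnegative with mass \<open>(2 * pi) ^ DIM('a)\<close>, so only
  the sup bound of \<open>w\<close> survives, uniformly in \<epsilon> and \<open>x\<close>.\<close>

lemma gauss_pairing_fourier_le:
  fixes w :: "'a::euclidean_space \<Rightarrow> real"
  assumes \<epsilon>: "0 < \<epsilon>" and w: "integrable lborel w" and b: "\<And>y. \<bar>w y\<bar> \<le> M"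
  shows "norm (gauss_pairing \<epsilon> x (fourier w)) \<le> (2 * pi) ^ DIM('a) * M"
proof -
  have k: "integrable lborel (\<lambda>y. gauss_kernel \<epsilon> (x - y))"
    "(LINT y|lborel. gauss_kernel \<epsilon> (x - y)) = (2 * pi) ^ DIM('a)"
    using lborel_integrable_affine_iff[of "gauss_kernel \<epsilon>" "-1" x] lborel_integral_affine[of "gauss_kernel \<epsilon>" "-1" x]
      gauss_kernel_integral[OF \<epsilon>, where 'a = 'a] by simp_all
  have "norm (gauss_pairing \<epsilon> x (fourier w)) = \<bar>LINT y|lborel. w y * gauss_kernel \<epsilon> (x - y)\<bar>"
    unfolding gauss_pairing_fourier[OF \<epsilon> w] by simp
  also have "\<dots> \<le> (LINT y|lborel. \<bar>w y * gauss_kernel \<epsilon> (x - y)\<bar>)"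
    by (rule integral_abs_bound)
  also have "\<dots> \<le> (LINT y|lborel. M * gauss_kernel \<epsilon> (x - y))"
    using k(1) order_trans[OF abs_ge_zero b]
    by (intro integral_mono') (auto simp: abs_mult gauss_kernel_nonneg \<epsilon> intro!: mult_mono b)
  finally show ?thesis using k by (simp add: mult.commute)
qed

text \<open>The Borel counterpart of \<open>convolution_measure\<close>, with no completion;
  \<open>convolution_measure_AE_eq\<close> identifies the two almost everywhere.\<close>

definition convolve :: "'a::euclidean_space measure \<Rightarrow> ('a \<Rightarrow> real) \<Rightarrow> 'a \<Rightarrow> real" where
  "convolve \<nu> w x = (LINT y|\<nu>. w (x - y))"

text \<open>Both parts are Fubini: by translation invariance the inner integral of |w(x - y)| over
  \<open>x\<close> is constant in \<open>y\<close>, and a finite measure integrates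
  constants.\<close>

lemma convolve:
  fixes w :: "'a::euclidean_space \<Rightarrow> real"
  assumes \<nu>: "finite_measure \<nu>" and s [measurable_cong]: "sets \<nu> = sets borel" and w: "integrable lborel w"
  shows integrable_convolve: "integrable lborel (convolve \<nu> w)"
    and fourier_convolve: "fourier (convolve \<nu> w) \<xi> = fourier_measure \<nu> \<xi> * fourier w \<xi>"
proof -
  interpret \<nu>: finite_measure \<nu> by fact
  interpret pair_sigma_finite \<nu> "lborel :: 'a measure" ..
  have [measurable]: "w \<in> borel_measurable borel" using w by auto
  have int: "integrable (\<nu> \<Otimes>\<^sub>M lborel) (\<lambda>(y, x). w (x - y))"
  proof (rule Fubini_integrable)
    show "integrable \<nu> (\<lambda>y. LINT x|lborel. norm (case (y, x) of (y, x) \<Rightarrow> w (x - y)))"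
      using lborel_integral_translate[of "\<lambda>x. \<bar>w x\<bar>"] by simp
    show "AE y in \<nu>. integrable lborel (\<lambda>x. case (y, x) of (y, x) \<Rightarrow> w (x - y))"
      using w by (simp add: lborel_integrable_translate_iff)
  qed measurable
  show "integrable lborel (convolve \<nu> w)"
    unfolding convolve_def[abs_def] by (rule integrable_snd) (rule int)
  let ?f = "\<lambda>y x. complex_of_real (w (x - y)) * cis (- (x \<bullet> \<xi>))"
  have "integrable (\<nu> \<Otimes>\<^sub>M lborel) (\<lambda>(y, x). ?f y x)"
    by (rule Bochner_Integration.integrable_bound[OF int]) (auto simp: norm_mult)
  then have "(LINT x|lborel. (LINT y|\<nu>. ?f y x)) = (LINT y|\<nu>. (LINT x|lborel. ?f y x))"
    by (rule Fubini_integral)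
  moreover have "(LINT x|lborel. ?f y x) = cis (- (y \<bullet> \<xi>)) * fourier w \<xi>" for y
  proof -
    \<comment> \<open>Writing \<open>x\<close> as \<open>x - y + y\<close> makes the integrand a
      function of \<open>x - y\<close>, ready for translation.\<close>
    have "(LINT x|lborel. ?f y x) = (LINT x|lborel. complex_of_real (w (x - y)) * cis (- (x - y + y) \<bullet> \<xi>))"
      by simp
    also have "\<dots> = (LINT x|lborel. complex_of_real (w x) * cis (- (x + y) \<bullet> \<xi>))"
      by (rule lborel_integral_translate) measurable
    also have "\<dots> = (LINT x|lborel. cis (- (y \<bullet> \<xi>)) * (complex_of_real (w x) * cis (- (x \<bullet> \<xi>))))"
      by (intro Bochner_Integration.integral_cong refl) (simp add: cis_mult inner_diff_left algebra_simps)
    finally show ?thesis by (simp add: fourier_def)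
  qed
  moreover have "(LINT x|lborel. (LINT y|\<nu>. ?f y x)) = fourier (convolve \<nu> w) \<xi>"
    unfolding fourier_def convolve_def
    by (simp flip: integral_complex_of_real add: integral_mult_left_zero)
  ultimately show "fourier (convolve \<nu> w) \<xi> = fourier_measure \<nu> \<xi> * fourier w \<xi>"
    by (simp add: fourier_measure_def)
qed

lemma convolve_abs_le:
  assumes \<nu>: "finite_measure \<nu>" and b: "\<And>y. \<bar>w y\<bar> \<le> M"
  shows "\<bar>convolve \<nu> w x\<bar> \<le> M * measure \<nu> (space \<nu>)"
proof -
  interpret finite_measure \<nu> by fact
  have "\<bar>convolve \<nu> w x\<bar> \<le> (LINT y|\<nu>. \<bar>w (x - y)\<bar>)"
    unfolding convolve_def by (rule integral_abs_bound)
  also have "\<dots> \<le> (LINT y|\<nu>. M)"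
    using order_trans[OF abs_ge_zero b] by (intro integral_mono') (auto intro: b)
  finally show ?thesis by (simp add: mult.commute)
qed

text \<open>The witness is the k-fold convolution of \<open>w\<close> by \<nu>: each step multiplies
  the sup bound by the mass and the transform by \<open>fourier_measure \<nu>\<close>. These are the
  terms of the compound Poisson series.\<close>

lemma convolve_iterate:
  assumes \<nu>: "finite_measure \<nu>" and s: "sets \<nu> = sets borel"
    and w: "integrable lborel w" and b: "\<And>y. \<bar>w y\<bar> \<le> M"
  obtains w' where "integrable lborel w'" "\<And>y. \<bar>w' y\<bar> \<le> M * measure \<nu> (space \<nu>) ^ k"
    "\<And>\<xi>. fourier w' \<xi> = fourier_measure \<nu> \<xi> ^ k * fourier w \<xi>"
proof -
  have "\<exists>w'. integrable lborel w' \<and> (\<forall>y. \<bar>w' y\<bar> \<le> M * measure \<nu> (space \<nu>) ^ k) \<and>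
     (\<forall>\<xi>. fourier w' \<xi> = fourier_measure \<nu> \<xi> ^ k * fourier w \<xi>)"
  proof (induction k)
    case 0
    then show ?case using w b by auto
  next
    case (Suc k)
    then obtain w' where w': "integrable lborel w'" "\<And>y. \<bar>w' y\<bar> \<le> M * measure \<nu> (space \<nu>) ^ k"
      "\<And>\<xi>. fourier w' \<xi> = fourier_measure \<nu> \<xi> ^ k * fourier w \<xi>" by auto
    then show ?case
      using convolve_abs_le[OF \<nu> w'(2)] convolve[OF \<nu> s w'(1)]
      by (intro exI[of _ "convolve \<nu> w'"]) (auto simp: mult_ac)
  qed
  then show ?thesis using that by auto
qed

section \<open>Compound Poisson and Levy symbols act as contractions\<close>

lemma gauss_pairing_sum:
  fixes F :: "'i \<Rightarrow> 'a::euclidean_space \<Rightarrow> complex"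
  assumes "0 < \<epsilon>" "\<And>i. i \<in> I \<Longrightarrow> F i \<in> borel_measurable borel" "\<And>i \<xi>. i \<in> I \<Longrightarrow> norm (F i \<xi>) \<le> B i"
  shows "gauss_pairing \<epsilon> x (\<lambda>\<xi>. \<Sum>i\<in>I. F i \<xi>) = (\<Sum>i\<in>I. gauss_pairing \<epsilon> x (F i))"
  unfolding gauss_pairing_def sum_distrib_right
  by (rule Bochner_Integration.integral_sum, rule gauss_pairing_integrable[OF assms])

lemma gauss_pairing_cmult:
  "gauss_pairing \<epsilon> x (\<lambda>\<xi>. a * F \<xi>) = a * gauss_pairing \<epsilon> x F"
  unfolding gauss_pairing_def by (simp add: mult.assoc)

lemma exp_partial_sum_le:
  fixes y :: real
  assumes "0 \<le> y"
  shows "(\<Sum>k<n. y ^ k / fact k) \<le> exp y"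
proof -
  have "(\<lambda>k. y ^ k / fact k) sums exp y"
    using exp_converges[of y] by (simp add: scaleR_conv_of_real field_simps)
  then show ?thesis
    using assms sum_le_suminf[of "\<lambda>k. y ^ k / fact k" "{..<n}"]
    by (simp add: sums_iff)
qed

text \<open>With L the mass of \<nu>, the symbol is exp(-tL) times the sum of t^k/k! times the k-th
  power of the transform of \<nu>. Bounding the k-th term by its mass gives exp(-tL) times the
  exponential series of tL, which is 1; hence a contraction in the sup norm.\<close>

lemma gauss_pairing_compound_poisson:
  fixes w :: "'a::euclidean_space \<Rightarrow> real"
  assumes \<epsilon>: "0 < \<epsilon>" and \<nu>: "finite_measure \<nu>" and s: "sets \<nu> = sets borel"
    and w: "integrable lborel w" and b: "\<And>y. \<bar>w y\<bar> \<le> M" and t: "0 \<le> t"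
    and c: "\<And>\<xi>. fourier_measure \<nu> \<xi> = complex_of_real (c \<xi>)"
  shows "norm (gauss_pairing \<epsilon> x (\<lambda>\<xi>. exp (- t * (measure \<nu> (space \<nu>) - c \<xi>)) * fourier w \<xi>))
          \<le> (2 * pi) ^ DIM('a) * M"
proof -
  define L where "L = measure \<nu> (space \<nu>)"
  define W where "W = (LINT y|lborel. \<bar>w y\<bar>)"
  define F where "F k \<xi> = complex_of_real (t ^ k / fact k) * (fourier_measure \<nu> \<xi> ^ k * fourier w \<xi>)" for k \<xi>
  have [measurable]: "w \<in> borel_measurable borel" using w by auto
  have [measurable]: "fourier_measure \<nu> \<in> borel_measurable borel"
    by (intro fourier_measure_measurable finite_measure.axioms(1) \<nu> s)
  have L: "0 \<le> L" by (simp add: L_def)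
  have Fm [measurable]: "F k \<in> borel_measurable borel" for k
    unfolding F_def by measurable
  \<comment> \<open>This bound goes through the L^1 norm of \<open>w\<close> and only justifies
    termwise integration and the limit; the estimate that survives uses the sup bound
    \<open>M\<close> instead.\<close>
  have Fb: "norm (F k \<xi>) \<le> ((t * L) ^ k / fact k) * W" for k \<xi>
  proof -
    have "norm (fourier_measure \<nu> \<xi> ^ k * fourier w \<xi>) \<le> L ^ k * W"
      unfolding norm_mult norm_power L_def W_def
      by (intro mult_mono power_mono fourier_measure_norm_le fourier_norm_le \<nu> w) auto
    then show ?thesis
      using mult_left_mono[of "norm (fourier_measure \<nu> \<xi> ^ k * fourier w \<xi>)" "L ^ k * W" "t ^ k / fact k"] t
      by (simp add: F_def norm_mult norm_divide norm_power power_mult_distrib mult_ac)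
  qed
  have W: "0 \<le> W" by (simp add: W_def)
  have "(\<lambda>n. gauss_pairing \<epsilon> x (\<lambda>\<xi>. \<Sum>k<n. F k \<xi>)) \<longlonglongrightarrow>
        gauss_pairing \<epsilon> x (\<lambda>\<xi>. exp (of_real t * fourier_measure \<nu> \<xi>) * fourier w \<xi>)"
  proof (rule gauss_pairing_tendsto[OF \<epsilon>])
    show "norm (\<Sum>k<n. F k \<xi>) \<le> exp (t * L) * W" for n \<xi>
    proof -
      have "norm (\<Sum>k<n. F k \<xi>) \<le> (\<Sum>k<n. ((t * L) ^ k / fact k) * W)"
        by (rule sum_norm_le) (rule Fb)
      also have "\<dots> \<le> exp (t * L) * W"
        unfolding sum_distrib_right[symmetric] using t L W
        by (intro mult_right_mono exp_partial_sum_le) auto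
      finally show ?thesis .
    qed
    show "(\<lambda>n. \<Sum>k<n. F k \<xi>) \<longlonglongrightarrow> exp (of_real t * fourier_measure \<nu> \<xi>) * fourier w \<xi>" for \<xi>
    proof -
      have "(\<lambda>k. F k \<xi>) sums (exp (of_real t * fourier_measure \<nu> \<xi>) * fourier w \<xi>)"
        using sums_mult2[OF exp_converges[of "of_real t * fourier_measure \<nu> \<xi>"], of "fourier w \<xi>"]
        by (simp add: F_def scaleR_conv_of_real power_mult_distrib field_simps)
      then show ?thesis by (simp add: sums_def)
    qed
  qed measurable
  moreover have "norm (gauss_pairing \<epsilon> x (\<lambda>\<xi>. \<Sum>k<n. F k \<xi>)) \<le> (2 * pi) ^ DIM('a) * M * exp (t * L)" for n
  proof -
    have k: "norm (gauss_pairing \<epsilon> x (F k)) \<le> ((t * L) ^ k / fact k) * ((2 * pi) ^ DIM('a) * M)" for k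
    proof -
      obtain w' where w': "integrable lborel w'" "\<And>y. \<bar>w' y\<bar> \<le> M * L ^ k"
        "\<And>\<xi>. fourier w' \<xi> = fourier_measure \<nu> \<xi> ^ k * fourier w \<xi>"
        using convolve_iterate[OF \<nu> s w b] unfolding L_def by metis
      have "gauss_pairing \<epsilon> x (F k) = complex_of_real (t ^ k / fact k) * gauss_pairing \<epsilon> x (fourier w')"
        unfolding F_def w'(3)[symmetric] by (rule gauss_pairing_cmult)
      then show ?thesis
        using mult_left_mono[OF gauss_pairing_fourier_le[OF \<epsilon> w'(1,2), of x], of "t ^ k / fact k"] t
        by (simp add: norm_mult norm_divide norm_power power_mult_distrib mult_ac)
    qed
    have "gauss_pairing \<epsilon> x (\<lambda>\<xi>. \<Sum>k<n. F k \<xi>) = (\<Sum>k<n. gauss_pairing \<epsilon> x (F k))"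
      by (rule gauss_pairing_sum[OF \<epsilon> Fm Fb])
    also have "norm \<dots> \<le> (\<Sum>k<n. ((t * L) ^ k / fact k) * ((2 * pi) ^ DIM('a) * M))"
      by (rule sum_norm_le) (rule k)
    also have "\<dots> \<le> exp (t * L) * ((2 * pi) ^ DIM('a) * M)"
      unfolding sum_distrib_right[symmetric] using t L order_trans[OF abs_ge_zero b]
      by (intro mult_right_mono exp_partial_sum_le) auto
    finally show ?thesis by (simp add: mult_ac)
  qed
  ultimately have le: "norm (gauss_pairing \<epsilon> x (\<lambda>\<xi>. exp (of_real t * fourier_measure \<nu> \<xi>) * fourier w \<xi>))
      \<le> (2 * pi) ^ DIM('a) * M * exp (t * L)"
    by (intro LIMSEQ_le_const2[OF tendsto_norm]) auto
  \<comment> \<open>Restoring the factor exp(-tL) cancels the growth exp(tL) of the series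
    bound.\<close>
  have "(\<lambda>\<xi>. exp (- t * (measure \<nu> (space \<nu>) - c \<xi>)) * fourier w \<xi>) =
      (\<lambda>\<xi>. complex_of_real (exp (- t * L)) * (exp (of_real t * fourier_measure \<nu> \<xi>) * fourier w \<xi>))"
    by (simp add: c L_def exp_of_real[symmetric] exp_add[symmetric] algebra_simps flip: of_real_mult)
  then have "norm (gauss_pairing \<epsilon> x (\<lambda>\<xi>. exp (- t * (measure \<nu> (space \<nu>) - c \<xi>)) * fourier w \<xi>)) =
      exp (- t * L) * norm (gauss_pairing \<epsilon> x (\<lambda>\<xi>. exp (of_real t * fourier_measure \<nu> \<xi>) * fourier w \<xi>))"
    by (simp add: gauss_pairing_cmult norm_mult)
  also have "\<dots> \<le> exp (- t * L) * ((2 * pi) ^ DIM('a) * M * exp (t * L))"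
    by (intro mult_left_mono le) simp
  finally show ?thesis by (simp add: exp_minus field_simps)
qed

section \<open>Symbols of even integrable kernels\<close>

definition cosine_transform :: "('a::euclidean_space \<Rightarrow> real) \<Rightarrow> 'a \<Rightarrow> real" where
  "cosine_transform K \<xi> = (LINT z|lborel. cos (z \<bullet> \<xi>) * K z)"

text \<open>\<open>multiplier\<close> over \<open>lborel\<close>, for the Borel pieces into which
  the kernel will be split.\<close>

definition levy_symbol :: "('a::euclidean_space \<Rightarrow> real) \<Rightarrow> 'a \<Rightarrow> real" where
  "levy_symbol K \<xi> = (LINT z|lborel. (1 - cos (z \<bullet> \<xi>)) * K z)"

lemma
  assumes [measurable]: "K \<in> borel_measurable borel"
  shows cosine_transform_measurable [measurable]: "cosine_transform K \<in> borel_measurable borel"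
    and levy_symbol_measurable [measurable]: "levy_symbol K \<in> borel_measurable borel"
  unfolding cosine_transform_def[abs_def] levy_symbol_def[abs_def] by measurable

lemma levy_symbol_nonneg: "(\<And>z. 0 \<le> K z) \<Longrightarrow> 0 \<le> levy_symbol K \<xi>"
  unfolding levy_symbol_def by (intro integral_nonneg_AE AE_I2 mult_nonneg_nonneg) auto

lemma integrable_cos_mult:
  fixes K :: "'a::euclidean_space \<Rightarrow> real"
  assumes "integrable lborel K"
  shows "integrable lborel (\<lambda>z. cos (z \<bullet> \<xi>) * K z)" "integrable lborel (\<lambda>z. sin (z \<bullet> \<xi>) * K z)"
proof -
  have [measurable]: "K \<in> borel_measurable borel" using assms by auto
  show "integrable lborel (\<lambda>z. cos (z \<bullet> \<xi>) * K z)" "integrable lborel (\<lambda>z. sin (z \<bullet> \<xi>) * K z)"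
    by (rule Bochner_Integration.integrable_bound[OF assms];
        force simp: abs_mult intro!: AE_I2 mult_left_le_one_le)+
qed

lemma levy_symbol_eq_diff:
  assumes "integrable lborel K"
  shows "levy_symbol K \<xi> = integral\<^sup>L lborel K - cosine_transform K \<xi>"
  unfolding levy_symbol_def cosine_transform_def using assms integrable_cos_mult[OF assms]
  by (simp add: left_diff_distrib)

text \<open>The sine part is odd, so reflection makes its integral equal to its own negative.
  Realness of the transform is what the compound Poisson estimate asks of its
  \<open>c\<close>.\<close>

lemma fourier_even:
  fixes K :: "'a::euclidean_space \<Rightarrow> real"
  assumes K: "integrable lborel K" and even: "\<And>z. K (- z) = K z"
  shows "fourier K \<xi> = complex_of_real (cosine_transform K \<xi>)"
proof -
  have [measurable]: "K \<in> borel_measurable borel" using K by auto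
  have "(LINT z|lborel. sin (z \<bullet> \<xi>) * K z) = (LINT z|lborel. sin (- z \<bullet> \<xi>) * K (- z))"
    by (rule lborel_integral_reflect[symmetric]) measurable
  then have s: "(LINT z|lborel. sin (z \<bullet> \<xi>) * K z) = 0"
    by (simp add: even)
  have "fourier K \<xi> = (LINT z|lborel. complex_of_real (cos (z \<bullet> \<xi>) * K z) - \<i> * complex_of_real (sin (z \<bullet> \<xi>) * K z))"
    unfolding fourier_def by (intro Bochner_Integration.integral_cong refl) (simp add: cis.ctr complex_eq_iff)
  also have "\<dots> = complex_of_real (LINT z|lborel. cos (z \<bullet> \<xi>) * K z) - \<i> * complex_of_real (LINT z|lborel. sin (z \<bullet> \<xi>) * K z)"
    using integrable_cos_mult[OF K, of \<xi>]
    by (subst Bochner_Integration.integral_diff)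
       (auto simp only: integral_mult_right_zero integral_complex_of_real intro!: integrable_mult_right integrable_of_real)
  finally show ?thesis by (simp add: s cosine_transform_def)
qed

lemma density_kernel:
  fixes K :: "'a::euclidean_space \<Rightarrow> real"
  assumes K: "integrable lborel K" and nn: "\<And>z. 0 \<le> K z"
  shows finite_measure_density_kernel: "finite_measure (density lborel K)"
    and measure_density_kernel: "measure (density lborel K) UNIV = integral\<^sup>L lborel K"
    and fourier_measure_density: "fourier_measure (density lborel K) \<xi> = fourier K \<xi>"
proof -
  have [measurable]: "K \<in> borel_measurable borel" using K by auto
  have e: "emeasure (density lborel K) UNIV = ennreal (integral\<^sup>L lborel K)"
    using K nn by (simp add: emeasure_density nn_integral_eq_integral)
  then show "finite_measure (density lborel K)"
    by (intro finite_measureI) simp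
  show "measure (density lborel K) UNIV = integral\<^sup>L lborel K"
    using e nn by (simp add: measure_def)
  show "fourier_measure (density lborel K) \<xi> = fourier K \<xi>"
    unfolding fourier_measure_def fourier_def
    by (subst integral_density) (auto simp: nn scaleR_conv_of_real)
qed

section \<open>Symbols of kernels that may be singular at the origin\<close>

lemma one_minus_cos_le: "1 - cos (x::real) \<le> x\<^sup>2 / 2"
proof -
  have "(sin (x / 2))\<^sup>2 \<le> (x / 2)\<^sup>2"
    using abs_sin_x_le_abs_x[of "x / 2"] by (simp only: abs_le_square_iff)
  then show ?thesis using cos_double_sin[of "x / 2"] by (simp add: power_divide)
qed

text \<open>The quadratic bound serves small \<open>z\<close> and the trivial bound 2 serves large
  \<open>z\<close>; the coefficient is chosen to cover both. It makes the symbol converge under the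
  Levy integrability condition.\<close>

lemma one_minus_cos_le_min:
  fixes z \<xi> :: "'a::euclidean_space"
  shows "1 - cos (z \<bullet> \<xi>) \<le> (2 + (norm \<xi>)\<^sup>2) * min ((norm z)\<^sup>2) 1"
proof -
  have "1 - cos (z \<bullet> \<xi>) \<le> (z \<bullet> \<xi>)\<^sup>2 / 2" by (rule one_minus_cos_le)
  also have "\<dots> \<le> (z \<bullet> \<xi>)\<^sup>2" by simp
  also have "\<dots> \<le> (norm z * norm \<xi>)\<^sup>2"
    using Cauchy_Schwarz_ineq2[of z \<xi>] by (metis abs_ge_zero power2_abs power_mono)
  also have "\<dots> \<le> (2 + (norm \<xi>)\<^sup>2) * (norm z)\<^sup>2"
    by (simp add: power_mult_distrib algebra_simps)
  finally have 1: "1 - cos (z \<bullet> \<xi>) \<le> (2 + (norm \<xi>)\<^sup>2) * (norm z)\<^sup>2" .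
  have 2: "1 - cos (z \<bullet> \<xi>) \<le> 2 + (norm \<xi>)\<^sup>2"
    using cos_ge_minus_one[of "z \<bullet> \<xi>"] by (smt (verit) zero_le_power2)
  show ?thesis using 1 2 by (simp add: min_def)
qed

text \<open>The mass of the truncated kernels may diverge as the cut-off is removed, but the
  compound Poisson bound does not see the mass, so it passes to the limit.\<close>

lemma gauss_pairing_levy_symbol:
  fixes w K :: "'a::euclidean_space \<Rightarrow> real"
  assumes \<epsilon>: "0 < \<epsilon>" and w: "integrable lborel w" and b: "\<And>y. \<bar>w y\<bar> \<le> M" and t: "0 \<le> t"
    and [measurable]: "K \<in> borel_measurable borel" and nn: "\<And>z. 0 \<le> K z" and even: "\<And>z. K (- z) = K z"
    and K: "integrable lborel (\<lambda>z. K z * min ((norm z)\<^sup>2) 1)"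
  shows "norm (gauss_pairing \<epsilon> x (\<lambda>\<xi>. exp (- t * levy_symbol K \<xi>) * fourier w \<xi>)) \<le> (2 * pi) ^ DIM('a) * M"
proof -
  \<comment> \<open>The cut-off discards |z| < 1/(n+1).\<close>
  define k where "k n z = (if 1 \<le> real (Suc n) * norm z then K z else 0)" for n z
  have [measurable]: "w \<in> borel_measurable borel" using w by auto
  have [measurable]: "k n \<in> borel_measurable borel" for n unfolding k_def by measurable
  have k: "integrable lborel (k n)" for n
  proof (rule Bochner_Integration.integrable_bound)
    show "integrable lborel (\<lambda>z. (real (Suc n))\<^sup>2 * (K z * min ((norm z)\<^sup>2) 1))"
      by (intro integrable_mult_right K)
    \<comment> \<open>Where \<open>k n\<close> does not vanish, the weight min(|z|^2, 1) is at least
      1/(n+1)^2, which gives the constant.\<close>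
    have "k n z \<le> (real (Suc n))\<^sup>2 * (K z * min ((norm z)\<^sup>2) 1)" for z
    proof (cases "1 \<le> real (Suc n) * norm z")
      case True
      then have "1 \<le> (real (Suc n) * norm z)\<^sup>2" "1 \<le> (real (Suc n))\<^sup>2"
        by (simp_all add: one_le_power)
      then have "1 \<le> (real (Suc n))\<^sup>2 * min ((norm z)\<^sup>2) 1"
        by (auto simp: min_def power_mult_distrib)
      from mult_left_mono[OF this nn[of z]] show ?thesis using True by (simp add: k_def mult_ac)
    qed (use nn in \<open>auto simp: k_def\<close>)
    moreover have "0 \<le> k n z" for z using nn by (simp add: k_def)
    ultimately show "AE z in lborel. norm (k n z) \<le> norm ((real (Suc n))\<^sup>2 * (K z * min ((norm z)\<^sup>2) 1))"
      by (intro AE_I2) (smt (verit, ccfv_threshold) real_norm_def)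
  qed measurable
  have knn: "0 \<le> k n z" and keven: "k n (- z) = k n z" for n z
    using nn even by (auto simp: k_def)
  have lim: "(\<lambda>n. levy_symbol (k n) \<xi>) \<longlonglongrightarrow> levy_symbol K \<xi>" for \<xi>
    unfolding levy_symbol_def
  proof (rule integral_dominated_convergence)
    show "integrable lborel (\<lambda>z. (2 + (norm \<xi>)\<^sup>2) * (K z * min ((norm z)\<^sup>2) 1))"
      by (intro integrable_mult_right K)
    show "AE z in lborel. norm ((1 - cos (z \<bullet> \<xi>)) * k n z) \<le> (2 + (norm \<xi>)\<^sup>2) * (K z * min ((norm z)\<^sup>2) 1)" for n
    proof (rule AE_I2)
      fix z
      have "k n z \<le> K z" using nn by (simp add: k_def)
      then have "(1 - cos (z \<bullet> \<xi>)) * k n z \<le> ((2 + (norm \<xi>)\<^sup>2) * min ((norm z)\<^sup>2) 1) * K z"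
        by (intro mult_mono one_minus_cos_le_min knn) auto
      then show "norm ((1 - cos (z \<bullet> \<xi>)) * k n z) \<le> (2 + (norm \<xi>)\<^sup>2) * (K z * min ((norm z)\<^sup>2) 1)"
        using knn[of n z] by (simp add: abs_mult mult_ac)
    qed
    have "AE z in lborel. z \<noteq> (0::'a)" by (rule AE_lborel_singleton)
    then show "AE z in lborel. (\<lambda>n. (1 - cos (z \<bullet> \<xi>)) * k n z) \<longlonglongrightarrow> (1 - cos (z \<bullet> \<xi>)) * K z"
    proof eventually_elim
      case (elim z)
      have "\<forall>\<^sub>F n in sequentially. 1 / norm z \<le> real n"
        using eventually_ge_at_top[of "nat \<lceil>1 / norm z\<rceil>"] by eventually_elim (simp add: nat_le_iff ceiling_le_iff)
      then have "\<forall>\<^sub>F n in sequentially. k n z = K z"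
      proof eventually_elim
        case (elim n)
        then have "1 \<le> real n * norm z" using \<open>z \<noteq> 0\<close> by (simp add: divide_le_eq)
        also have "\<dots> \<le> real (Suc n) * norm z" by (intro mult_right_mono) auto
        finally show ?case by (simp add: k_def)
      qed
      then have "(\<lambda>n. k n z) \<longlonglongrightarrow> K z" by (rule tendsto_eventually)
      then show ?case by (intro tendsto_intros)
    qed
  qed measurable
  have "(\<lambda>n. gauss_pairing \<epsilon> x (\<lambda>\<xi>. complex_of_real (exp (- t * levy_symbol (k n) \<xi>)) * fourier w \<xi>)) \<longlonglongrightarrow>
      gauss_pairing \<epsilon> x (\<lambda>\<xi>. complex_of_real (exp (- t * levy_symbol K \<xi>)) * fourier w \<xi>)"
  proof (rule gauss_pairing_tendsto[OF \<epsilon>])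
    show "(\<lambda>\<xi>. complex_of_real (exp (- t * levy_symbol (k n) \<xi>)) * fourier w \<xi>) \<in> borel_measurable borel" for n
      by measurable
    show "norm (complex_of_real (exp (- t * levy_symbol (k n) \<xi>)) * fourier w \<xi>) \<le> 1 * (LINT y|lborel. \<bar>w y\<bar>)" for n \<xi>
      unfolding norm_mult using levy_symbol_nonneg[of "k n" \<xi>] knn t
      by (intro mult_mono fourier_norm_le w) auto
    show "(\<lambda>n. complex_of_real (exp (- t * levy_symbol (k n) \<xi>)) * fourier w \<xi>) \<longlonglongrightarrow>
        complex_of_real (exp (- t * levy_symbol K \<xi>)) * fourier w \<xi>" for \<xi>
      by (intro tendsto_intros lim)
  qed
  moreover have "norm (gauss_pairing \<epsilon> x (\<lambda>\<xi>. complex_of_real (exp (- t * levy_symbol (k n) \<xi>)) * fourier w \<xi>))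
      \<le> (2 * pi) ^ DIM('a) * M" for n
  proof -
    have "fourier_measure (density lborel (k n)) \<xi> = complex_of_real (cosine_transform (k n) \<xi>)" for \<xi>
      using fourier_measure_density[OF k knn] fourier_even[OF k keven] by simp
    from gauss_pairing_compound_poisson[OF \<epsilon> finite_measure_density_kernel[OF k knn] _ w b t this, of x]
    show ?thesis
      by (simp add: measure_density_kernel[OF k knn] levy_symbol_eq_diff[OF k])
  qed
  ultimately show ?thesis
    by (intro LIMSEQ_le_const2[OF tendsto_norm]) auto
qed

section \<open>Decay of the regularised solution\<close>

text \<open>Half of Plancherel: \<open>C\<^sup>2\<close> is the transform of the bounded function \<open>k * k\<close>, so its Gaussian means are
  bounded, and Fatou applies.\<close>

lemma cosine_transform_square_integrable:
  fixes k :: "'a::euclidean_space \<Rightarrow> real"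
  assumes k: "integrable lborel k" and nn: "\<And>z. 0 \<le> k z" and kb: "\<And>z. k z \<le> b" and even: "\<And>z. k (- z) = k z"
  shows "integrable lborel (\<lambda>\<xi>. (cosine_transform k \<xi>)\<^sup>2)"
proof -
  let ?C = "cosine_transform k"
  define \<nu> where "\<nu> = density lborel k"
  define B where "B = (2 * pi) ^ DIM('a) * (b * measure \<nu> (space \<nu>))"
  have [measurable]: "k \<in> borel_measurable borel" using k by auto
  have \<nu>: "finite_measure \<nu>" "sets \<nu> = sets borel"
    unfolding \<nu>_def by (rule finite_measure_density_kernel[OF k nn]) simp
  have kb': "\<bar>k z\<bar> \<le> b" for z using nn kb by (simp add: abs_of_nonneg)
  \<comment> \<open>\<nu> has density \<open>k\<close>, so \<open>convolve \<nu> k\<close> is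
    \<open>k * k\<close> and its transform is the square of \<open>?C\<close>.\<close>
  have F: "fourier (convolve \<nu> k) = (\<lambda>\<xi>. complex_of_real ((?C \<xi>)\<^sup>2))"
    using fourier_convolve[OF \<nu> k] fourier_measure_density[OF k nn] fourier_even[OF k even]
    by (simp add: \<nu>_def power2_eq_square fun_eq_iff)
  have "norm (?C \<xi>) \<le> (LINT y|lborel. \<bar>k y\<bar>)" for \<xi>
    using fourier_norm_le[OF k, of \<xi>] fourier_even[OF k even, of \<xi>] by simp
  then have Cb: "norm (complex_of_real ((?C \<xi>)\<^sup>2)) \<le> (LINT y|lborel. \<bar>k y\<bar>)\<^sup>2" for \<xi>
    using power_mono[of "norm (?C \<xi>)" "LINT y|lborel. \<bar>k y\<bar>" 2] by (simp add: norm_power)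
  have int: "integrable lborel (\<lambda>\<xi>. (?C \<xi>)\<^sup>2 * gauss_weight \<epsilon> \<xi>)"
    and le: "(LINT \<xi>|lborel. (?C \<xi>)\<^sup>2 * gauss_weight \<epsilon> \<xi>) \<le> B" if \<epsilon>: "0 < \<epsilon>" for \<epsilon>
  proof -
    have "integrable lborel (\<lambda>\<xi>. complex_of_real ((?C \<xi>)\<^sup>2 * gauss_weight \<epsilon> \<xi>))"
      using gauss_pairing_integrable[where x = 0 and F = "\<lambda>\<xi>. complex_of_real ((?C \<xi>)\<^sup>2)", OF \<epsilon> _ Cb] by simp
    then show int: "integrable lborel (\<lambda>\<xi>. (?C \<xi>)\<^sup>2 * gauss_weight \<epsilon> \<xi>)"
      using complex_of_real_integrable_eq by blast
    \<comment> \<open>At the point 0 the character is 1, so the pairing is exactly the Gaussian mean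
      of C^2, and the sup bound of \<open>k * k\<close> yields \<open>B\<close> for all \<epsilon>
      at once.\<close>
    have "gauss_pairing \<epsilon> 0 (fourier (convolve \<nu> k)) = complex_of_real (LINT \<xi>|lborel. (?C \<xi>)\<^sup>2 * gauss_weight \<epsilon> \<xi>)"
      unfolding F gauss_pairing_def integral_complex_of_real[symmetric] by simp
    then show "(LINT \<xi>|lborel. (?C \<xi>)\<^sup>2 * gauss_weight \<epsilon> \<xi>) \<le> B"
      using gauss_pairing_fourier_le[OF \<epsilon> integrable_convolve[OF \<nu> k] convolve_abs_le[OF \<nu>(1) kb'], of 0]
      by (simp add: B_def)
  qed
  have lim: "(\<lambda>n. ennreal ((?C \<xi>)\<^sup>2 * gauss_weight (1 / real (Suc n)) \<xi>)) \<longlonglongrightarrow> ennreal ((?C \<xi>)\<^sup>2)" for \<xi>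
  proof -
    have "(\<lambda>n. gauss_weight (1 / real (Suc n)) \<xi>) \<longlonglongrightarrow> exp (- 0 * (norm \<xi>)\<^sup>2 / 2)"
      unfolding gauss_weight_def by (intro tendsto_intros LIMSEQ_Suc[OF lim_1_over_n]) auto
    then have "(\<lambda>n. (?C \<xi>)\<^sup>2 * gauss_weight (1 / real (Suc n)) \<xi>) \<longlonglongrightarrow> (?C \<xi>)\<^sup>2 * 1"
      by (intro tendsto_intros) simp
    then show ?thesis by (intro tendsto_ennrealI) simp
  qed
  have "(\<integral>\<^sup>+ \<xi>. ennreal ((?C \<xi>)\<^sup>2) \<partial>lborel) = (\<integral>\<^sup>+ \<xi>. liminf (\<lambda>n. ennreal ((?C \<xi>)\<^sup>2 * gauss_weight (1 / real (Suc n)) \<xi>)) \<partial>lborel)"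
    by (intro nn_integral_cong lim_imp_Liminf[symmetric] lim) simp
  also have "\<dots> \<le> liminf (\<lambda>n. \<integral>\<^sup>+ \<xi>. ennreal ((?C \<xi>)\<^sup>2 * gauss_weight (1 / real (Suc n)) \<xi>) \<partial>lborel)"
    by (rule nn_integral_liminf) measurable
  also have "\<dots> \<le> liminf (\<lambda>n. ennreal B)"
  proof (intro Liminf_mono always_eventually allI)
    fix n
    have "(\<integral>\<^sup>+ \<xi>. ennreal ((?C \<xi>)\<^sup>2 * gauss_weight (1 / real (Suc n)) \<xi>) \<partial>lborel) =
        ennreal (LINT \<xi>|lborel. (?C \<xi>)\<^sup>2 * gauss_weight (1 / real (Suc n)) \<xi>)"
      by (rule nn_integral_eq_integral[OF int]) (auto simp: gauss_weight_def)
    also have "\<dots> \<le> ennreal B" by (intro ennreal_leI le) simp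
    finally show "(\<integral>\<^sup>+ \<xi>. ennreal ((?C \<xi>)\<^sup>2 * gauss_weight (1 / real (Suc n)) \<xi>) \<partial>lborel) \<le> ennreal B" .
  qed
  also have "\<dots> < \<infinity>" by (simp add: Liminf_const)
  finally show ?thesis by (intro integrableI_bounded) (simp_all add: ennreal_power)
qed

section \<open>Positivity of the symbol and decay of the remainder\<close>

lemma cosine_transform_abs_le:
  assumes "integrable lborel k" "\<And>z. 0 \<le> k z" "\<And>z. k (- z) = k z"
  shows "\<bar>cosine_transform k \<xi>\<bar> \<le> integral\<^sup>L lborel k"
  using fourier_norm_le[OF assms(1), of \<xi>] fourier_even[OF assms(1,3), of \<xi>] assms(2) by simp

text \<open>If the symbol vanished at \<xi>, \<open>k\<close> would be carried by the points where
  the cosine is 1. These form countably many parallel hyperplanes, a null set, which contradicts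
  positive mass.\<close>

lemma levy_symbol_pos:
  fixes k :: "'a::euclidean_space \<Rightarrow> real"
  assumes k: "integrable lborel k" and nn: "\<And>z. 0 \<le> k z" and pos: "0 < integral\<^sup>L lborel k" and \<xi>: "\<xi> \<noteq> 0"
  shows "0 < levy_symbol k \<xi>"
proof (rule ccontr)
  assume "\<not> 0 < levy_symbol k \<xi>"
  then have "(LINT z|lborel. (1 - cos (z \<bullet> \<xi>)) * k z) = 0"
    using levy_symbol_nonneg[of k \<xi>, OF nn] by (simp add: levy_symbol_def)
  moreover have "AE z in lborel. 0 \<le> (1 - cos (z \<bullet> \<xi>)) * k z"
    using nn by (intro AE_I2 mult_nonneg_nonneg) auto
  ultimately have "AE z in lborel. (1 - cos (z \<bullet> \<xi>)) * k z = 0"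
    using Bochner_Integration.integrable_diff[OF k integrable_cos_mult(1)[OF k, of \<xi>]] nn
    by (intro integral_nonneg_eq_0_iff_AE[THEN iffD1]) (auto simp: left_diff_distrib)
  moreover have "AE z in lborel. \<forall>j::int. \<xi> \<bullet> z \<noteq> of_int j * 2 * pi"
  proof (subst AE_all_countable, intro allI)
    fix j :: int
    have "{z. \<xi> \<bullet> z = of_int j * 2 * pi} \<in> null_sets lborel"
      using negligible_hyperplane[of \<xi> "of_int j * 2 * pi"] \<xi>
      by (simp add: negligible_iff_null_sets null_sets_completion_iff)
    then show "AE z in lborel. \<xi> \<bullet> z \<noteq> of_int j * 2 * pi"
      by (auto dest: AE_not_in)
  qed
  ultimately have "AE z in lborel. k z = 0"
    by eventually_elim (auto simp: cos_one_2pi_int inner_commute)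
  then have "integral\<^sup>L lborel k = 0" by (rule integral_eq_zero_AE)
  then show False using pos by simp
qed

text \<open>This is \<open>r\<^sub>t\<close>, the part of \<open>exp (- t (\<Lambda> - C))\<close> beyond first order in \<open>C\<close>.\<close>

definition heat_remainder :: "('a::euclidean_space \<Rightarrow> real) \<Rightarrow> real \<Rightarrow> 'a \<Rightarrow> real" where
  "heat_remainder k t \<xi> = exp (- t * levy_symbol k \<xi>)
     - exp (- t * integral\<^sup>L lborel k) * (1 + t * cosine_transform k \<xi>)"

text \<open>The bound is uniform in t, as domination requires, and 8 serves two regimes. If |C|
  \<le> \<Lambda>/2, Taylor leaves t^2 exp(-t\<Lambda>/2) C^2, and s^2/2 \<le> exp s at s =
  t\<Lambda>/2 gives 8/\<Lambda>^2. Otherwise the left side is at most 2, while C^2 > \<Lambda>^2/4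
  makes the right side at least 2.\<close>

lemma exp_remainder_le:
  fixes C \<Lambda> t :: real
  assumes C: "\<bar>C\<bar> \<le> \<Lambda>" and \<Lambda>: "0 < \<Lambda>" and t: "0 \<le> t"
  shows "\<bar>exp (- t * (\<Lambda> - C)) - exp (- t * \<Lambda>) * (1 + t * C)\<bar> \<le> 8 / \<Lambda>\<^sup>2 * C\<^sup>2"
proof (cases "\<bar>C\<bar> \<le> \<Lambda> / 2")
  case True
  have "norm (exp (t * C) - (\<Sum>i\<le>1. (t * C) ^ i / fact i)) \<le> exp (norm (t * C)) * norm (t * C) ^ Suc 1 / fact 1"
    by (rule Taylor_exp_field)
  then have "\<bar>exp (t * C) - (1 + t * C)\<bar> \<le> exp (t * \<bar>C\<bar>) * (t\<^sup>2 * C\<^sup>2)"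
    using t by (simp add: abs_mult power_mult_distrib power2_eq_square mult_ac)
  also have "\<dots> \<le> exp (t * (\<Lambda> / 2)) * (t\<^sup>2 * C\<^sup>2)"
    using True t by (intro mult_right_mono) (simp_all add: mult_left_mono del: times_divide_eq_right)
  finally have "exp (- t * \<Lambda>) * \<bar>exp (t * C) - (1 + t * C)\<bar> \<le> exp (- t * \<Lambda>) * (exp (t * (\<Lambda> / 2)) * (t\<^sup>2 * C\<^sup>2))"
    by (intro mult_left_mono) auto
  also have "\<dots> = (exp (- (t * \<Lambda> / 2)) * t\<^sup>2) * C\<^sup>2"
    by (simp add: exp_add[symmetric] mult.assoc[symmetric])
  also have "exp (- (t * \<Lambda> / 2)) * t\<^sup>2 \<le> 8 / \<Lambda>\<^sup>2"
  proof -
    have "1 + t * \<Lambda> / 2 + (t * \<Lambda> / 2)\<^sup>2 / 2 \<le> exp (t * \<Lambda> / 2)"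
      using t \<Lambda> by (intro exp_lower_Taylor_quadratic) auto
    moreover have "0 \<le> t * \<Lambda> / 2" using t \<Lambda> by simp
    ultimately have "(t * \<Lambda> / 2)\<^sup>2 / 2 \<le> exp (t * \<Lambda> / 2)" by linarith
    then have "exp (- (t * \<Lambda> / 2)) * ((t * \<Lambda> / 2)\<^sup>2 / 2) \<le> exp (- (t * \<Lambda> / 2)) * exp (t * \<Lambda> / 2)"
      by (intro mult_left_mono) auto
    also have "\<dots> = 1" by (simp add: exp_add[symmetric])
    finally show ?thesis using \<Lambda> by (simp add: power_mult_distrib power_divide field_simps)
  qed
  finally have "exp (- t * \<Lambda>) * \<bar>exp (t * C) - (1 + t * C)\<bar> \<le> 8 / \<Lambda>\<^sup>2 * C\<^sup>2"
    by (simp add: mult_right_mono)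
  moreover have "exp (- t * (\<Lambda> - C)) - exp (- t * \<Lambda>) * (1 + t * C) = exp (- t * \<Lambda>) * (exp (t * C) - (1 + t * C))"
    by (simp add: right_diff_distrib exp_add[symmetric])
  ultimately show ?thesis by (simp add: abs_mult)
next
  case False
  have "exp (- t * (\<Lambda> - C)) \<le> 1" using C t by (simp add: abs_le_iff)
  moreover have "exp (- t * \<Lambda>) * \<bar>1 + t * C\<bar> \<le> 1"
  proof -
    have "t * \<bar>C\<bar> \<le> t * \<Lambda>" by (intro mult_left_mono C t)
    then have "\<bar>1 + t * C\<bar> \<le> 1 + t * \<Lambda>"
      using t abs_triangle_ineq[of 1 "t * C"] by (simp add: abs_mult)
    also have "\<dots> \<le> exp (t * \<Lambda>)" by (rule exp_ge_add_one_self)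
    finally have "exp (- t * \<Lambda>) * \<bar>1 + t * C\<bar> \<le> exp (- t * \<Lambda>) * exp (t * \<Lambda>)"
      by (intro mult_left_mono) auto
    then show ?thesis by (simp add: exp_add[symmetric])
  qed
  ultimately have "\<bar>exp (- t * (\<Lambda> - C)) - exp (- t * \<Lambda>) * (1 + t * C)\<bar> \<le> 2"
    using abs_triangle_ineq4[of "exp (- t * (\<Lambda> - C))" "exp (- t * \<Lambda>) * (1 + t * C)"]
    unfolding abs_mult abs_exp_cancel by linarith
  also have "(\<Lambda> / 2)\<^sup>2 \<le> \<bar>C\<bar>\<^sup>2" using False \<Lambda> by (intro power_mono) auto
  then have "2 \<le> 8 / \<Lambda>\<^sup>2 * C\<^sup>2" using \<Lambda> by (simp add: power_divide field_simps)
  finally show ?thesis .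
qed

lemma exp_decay_tendsto:
  fixes a C :: real
  assumes "0 < a"
  shows "((\<lambda>t. exp (- t * a) * (1 + t * C)) \<longlongrightarrow> 0) at_top"
proof -
  have "((\<lambda>t. exp (- t * a)) \<longlongrightarrow> 0) at_top" "((\<lambda>t. t * exp (- t * a)) \<longlongrightarrow> 0) at_top"
    using assms by real_asymp+
  from tendsto_add[OF this(1) tendsto_mult_right[OF this(2), of C]] show ?thesis
    by (simp add: algebra_simps)
qed

text \<open>Dominated convergence: the quadratic bound in C does not depend on t, and C^2 is
  integrable.\<close>

lemma heat_remainder:
  fixes k :: "'a::euclidean_space \<Rightarrow> real"
  assumes k: "integrable lborel k" and nn: "\<And>z. 0 \<le> k z" and kb: "\<And>z. k z \<le> b" and even: "\<And>z. k (- z) = k z"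
    and pos: "0 < integral\<^sup>L lborel k"
  shows heat_remainder_integrable: "0 \<le> t \<Longrightarrow> integrable lborel (heat_remainder k t)"
    and heat_remainder_tendsto: "((\<lambda>t. LINT \<xi>|lborel. \<bar>heat_remainder k t \<xi>\<bar>) \<longlongrightarrow> 0) at_top"
proof -
  define \<Lambda> where "\<Lambda> = integral\<^sup>L lborel k"
  have [measurable]: "k \<in> borel_measurable borel" using k by auto
  have r: "heat_remainder k t \<xi> = exp (- t * (\<Lambda> - cosine_transform k \<xi>)) - exp (- t * \<Lambda>) * (1 + t * cosine_transform k \<xi>)" for t \<xi>
    by (simp add: heat_remainder_def levy_symbol_eq_diff[OF k] \<Lambda>_def)
  have [measurable]: "heat_remainder k t \<in> borel_measurable borel" for t
    unfolding heat_remainder_def[abs_def] by measurable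
  have le: "\<bar>heat_remainder k t \<xi>\<bar> \<le> 8 / \<Lambda>\<^sup>2 * (cosine_transform k \<xi>)\<^sup>2" if "0 \<le> t" for t \<xi>
    unfolding r by (rule exp_remainder_le) (use that pos cosine_transform_abs_le[OF k nn even] in \<open>auto simp: \<Lambda>_def\<close>)
  have dom: "integrable lborel (\<lambda>\<xi>. 8 / \<Lambda>\<^sup>2 * (cosine_transform k \<xi>)\<^sup>2)"
    by (intro integrable_mult_right cosine_transform_square_integrable[OF k nn kb even])
  show "integrable lborel (heat_remainder k t)" if "0 \<le> t"
    by (rule Bochner_Integration.integrable_bound[OF dom]) (use le[OF that] in \<open>auto simp: abs_mult\<close>)
  have "((\<lambda>t. LINT \<xi>|lborel. \<bar>heat_remainder k t \<xi>\<bar>) \<longlongrightarrow> (LINT \<xi>|(lborel :: 'a measure). 0)) at_top"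
  proof (rule integral_dominated_convergence_at_top[OF _ _ dom])
    show "\<forall>\<^sub>F t in at_top. AE \<xi> in lborel. norm \<bar>heat_remainder k t \<xi>\<bar> \<le> 8 / \<Lambda>\<^sup>2 * (cosine_transform k \<xi>)\<^sup>2"
      using eventually_ge_at_top[of 0] by eventually_elim (use le in auto)
    \<comment> \<open>The origin must be excluded: the symbol vanishes there and the remainder tends
      to 1.\<close>
    have "AE \<xi> in lborel. \<xi> \<noteq> (0::'a)" by (rule AE_lborel_singleton)
    then show "AE \<xi> in lborel. ((\<lambda>t. \<bar>heat_remainder k t \<xi>\<bar>) \<longlongrightarrow> 0) at_top"
    proof eventually_elim
      case (elim \<xi>)
      define C where "C = cosine_transform k \<xi>"
      have "0 < levy_symbol k \<xi>" "0 < \<Lambda>"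
        using levy_symbol_pos[OF k nn pos] elim pos by (auto simp: \<Lambda>_def)
      \<comment> \<open>The choice of 0 for the linear coefficient gives plain exponential decay of
        the first term.\<close>
      from tendsto_diff[OF exp_decay_tendsto[OF this(1), of 0] exp_decay_tendsto[OF this(2), of C]]
      have "((\<lambda>t. \<bar>exp (- t * levy_symbol k \<xi>) - exp (- t * \<Lambda>) * (1 + t * C)\<bar>) \<longlongrightarrow> 0) at_top"
        by (intro tendsto_rabs_zero) simp
      then show ?case by (simp add: heat_remainder_def \<Lambda>_def C_def)
    qed
  qed measurable
  then show "((\<lambda>t. LINT \<xi>|lborel. \<bar>heat_remainder k t \<xi>\<bar>) \<longlongrightarrow> 0) at_top" by simp
qed

text \<open>Three contributions: the remainder, integrated over frequencies with the transform of
  \<open>w\<close> bounded by its L^1 norm; the Dirac part, of weight exp(-t\<Lambda>); and the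
  linear part, of weight t exp(-t\<Lambda>). The last two use the sup norm.\<close>

lemma gauss_pairing_heat:
  fixes w k K :: "'a::euclidean_space \<Rightarrow> real"
  assumes \<epsilon>: "0 < \<epsilon>" and w: "integrable lborel w" and b: "\<And>y. \<bar>w y\<bar> \<le> M" and t: "0 \<le> t"
    and k: "integrable lborel k" "\<And>z. 0 \<le> k z" "\<And>z. k z \<le> b" "\<And>z. k (- z) = k z" "0 < integral\<^sup>L lborel k"
    and K: "K \<in> borel_measurable borel" "\<And>z. 0 \<le> K z" "\<And>z. K (- z) = K z"
      "integrable lborel (\<lambda>z. K z * min ((norm z)\<^sup>2) 1)"
  shows "norm (gauss_pairing \<epsilon> x (\<lambda>\<xi>. exp (- t * (levy_symbol k \<xi> + levy_symbol K \<xi>)) * fourier w \<xi>)) \<le>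
    (LINT y|lborel. \<bar>w y\<bar>) * (LINT \<xi>|lborel. \<bar>heat_remainder k t \<xi>\<bar>) +
    (2 * pi) ^ DIM('a) * M * ((1 + t * integral\<^sup>L lborel k) * exp (- t * integral\<^sup>L lborel k))"
proof -
  define \<Lambda> where "\<Lambda> = integral\<^sup>L lborel k"
  define W where "W = (LINT y|lborel. \<bar>w y\<bar>)"
  define \<nu> where "\<nu> = density lborel k"
  \<comment> \<open>Convolving by \<open>k\<close> absorbs the factor C of the linear term into the
    transform of a bounded integrable function, so C itself is never integrated.\<close>
  define w' where "w' = convolve \<nu> w"
  \<comment> \<open>The factor coming from \<open>K\<close> stays attached to the transform, since
    the contraction estimate applies to the pair as a whole.\<close>
  define G where "G f \<xi> = complex_of_real (exp (- t * levy_symbol K \<xi>)) * fourier f \<xi>" for f \<xi>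
  have [measurable]: "w \<in> borel_measurable borel" "k \<in> borel_measurable borel" "K \<in> borel_measurable borel"
    using w k K by auto
  have \<nu>: "finite_measure \<nu>" "sets \<nu> = sets borel" "measure \<nu> (space \<nu>) = \<Lambda>"
    using finite_measure_density_kernel[OF k(1,2)] measure_density_kernel[OF k(1,2)] by (auto simp: \<nu>_def \<Lambda>_def)
  have w': "integrable lborel w'" "\<And>y. \<bar>w' y\<bar> \<le> M * \<Lambda>"
    "\<And>\<xi>. fourier w' \<xi> = complex_of_real (cosine_transform k \<xi>) * fourier w \<xi>"
    using integrable_convolve[OF \<nu>(1,2) w] convolve_abs_le[OF \<nu>(1) b] fourier_convolve[OF \<nu>(1,2) w]
      fourier_measure_density[OF k(1,2)] fourier_even[OF k(1,4)] \<nu>(3)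
    by (auto simp: w'_def \<nu>_def)
  have [measurable]: "w' \<in> borel_measurable borel" using w' by auto
  have [measurable]: "G f \<in> borel_measurable borel" if [measurable]: "f \<in> borel_measurable borel" for f
    unfolding G_def by measurable
  have Gb: "norm (G f \<xi>) \<le> (LINT y|lborel. \<bar>f y\<bar>)" if "integrable lborel f" for f \<xi>
  proof -
    have "norm (G f \<xi>) \<le> 1 * (LINT y|lborel. \<bar>f y\<bar>)"
      unfolding G_def norm_mult using levy_symbol_nonneg[of K \<xi>, OF K(2)] t
      by (intro mult_mono fourier_norm_le that) auto
    then show ?thesis by simp
  qed
  have Gle: "norm (gauss_pairing \<epsilon> x (G f)) \<le> (2 * pi) ^ DIM('a) * M'"
    if "integrable lborel f" "\<And>y. \<bar>f y\<bar> \<le> M'" for f M'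
    unfolding G_def by (rule gauss_pairing_levy_symbol[OF \<epsilon> that t K])
  have rb: "norm (complex_of_real (heat_remainder k t \<xi>) * G w \<xi>) \<le> \<bar>heat_remainder k t \<xi>\<bar> * W" for \<xi>
    unfolding norm_mult W_def by (intro mult_mono Gb w) auto
  have ri: "integrable lborel (heat_remainder k t)"
    by (rule heat_remainder_integrable[OF k t])
  have [measurable]: "heat_remainder k t \<in> borel_measurable borel" using ri by auto
  have rG: "integrable lborel (\<lambda>\<xi>. complex_of_real (heat_remainder k t \<xi>) * G w \<xi>)"
    by (rule Bochner_Integration.integrable_bound[of _ "\<lambda>\<xi>. \<bar>heat_remainder k t \<xi>\<bar> * W"])
       (use rb ri in \<open>auto intro!: AE_I2 order_trans[OF rb]\<close>)
  have split: "(\<lambda>\<xi>. exp (- t * (levy_symbol k \<xi> + levy_symbol K \<xi>)) * fourier w \<xi>) =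
      (\<lambda>\<xi>. complex_of_real (heat_remainder k t \<xi>) * G w \<xi> + complex_of_real (exp (- t * \<Lambda>)) * G w \<xi>
        + complex_of_real (t * exp (- t * \<Lambda>)) * G w' \<xi>)"
  proof
    fix \<xi>
    have "exp (- t * (levy_symbol k \<xi> + levy_symbol K \<xi>)) = exp (- t * levy_symbol k \<xi>) * exp (- t * levy_symbol K \<xi>)"
      by (simp add: exp_add[symmetric] distrib_left)
    then show "exp (- t * (levy_symbol k \<xi> + levy_symbol K \<xi>)) * fourier w \<xi> =
      complex_of_real (heat_remainder k t \<xi>) * G w \<xi> + complex_of_real (exp (- t * \<Lambda>)) * G w \<xi>
        + complex_of_real (t * exp (- t * \<Lambda>)) * G w' \<xi>"
      by (simp only: heat_remainder_def \<Lambda>_def G_def w'(3)) (simp add: algebra_simps)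
  qed
  have i: "integrable lborel (\<lambda>\<xi>. complex_of_real (heat_remainder k t \<xi>) * G w \<xi> * (complex_of_real (gauss_weight \<epsilon> \<xi>) * cis (x \<bullet> \<xi>)))"
    by (rule Bochner_Integration.integrable_bound[OF rG])
       (use \<epsilon> in \<open>auto simp: norm_mult[of "_ * G w _"] intro!: AE_I2 mult_left_le norm_gauss_weight_cis_le\<close>)
  have j: "integrable lborel (\<lambda>\<xi>. c * G f \<xi> * (complex_of_real (gauss_weight \<epsilon> \<xi>) * cis (x \<bullet> \<xi>)))"
    if "integrable lborel f" for f c
    unfolding mult.assoc using that by (intro integrable_mult_right gauss_pairing_integrable[OF \<epsilon> _ Gb]) auto
  have "gauss_pairing \<epsilon> x (\<lambda>\<xi>. exp (- t * (levy_symbol k \<xi> + levy_symbol K \<xi>)) * fourier w \<xi>) =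
      gauss_pairing \<epsilon> x (\<lambda>\<xi>. complex_of_real (heat_remainder k t \<xi>) * G w \<xi>)
      + complex_of_real (exp (- t * \<Lambda>)) * gauss_pairing \<epsilon> x (G w)
      + complex_of_real (t * exp (- t * \<Lambda>)) * gauss_pairing \<epsilon> x (G w')"
    unfolding split gauss_pairing_cmult[symmetric] unfolding gauss_pairing_def distrib_right
    using i j[OF w] j[OF w'(1)] by (simp only: Bochner_Integration.integral_add Bochner_Integration.integrable_add)
  also have "norm \<dots> \<le> norm (gauss_pairing \<epsilon> x (\<lambda>\<xi>. complex_of_real (heat_remainder k t \<xi>) * G w \<xi>))
      + exp (- t * \<Lambda>) * norm (gauss_pairing \<epsilon> x (G w)) + t * exp (- t * \<Lambda>) * norm (gauss_pairing \<epsilon> x (G w'))"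
    using t by (intro order_trans[OF norm_triangle_ineq] add_mono) (auto simp: norm_mult)
  also have "\<dots> \<le> (LINT \<xi>|lborel. \<bar>heat_remainder k t \<xi>\<bar> * W)
      + exp (- t * \<Lambda>) * ((2 * pi) ^ DIM('a) * M) + t * exp (- t * \<Lambda>) * ((2 * pi) ^ DIM('a) * (M * \<Lambda>))"
  proof (intro add_mono mult_left_mono Gle w b w')
    show "norm (gauss_pairing \<epsilon> x (\<lambda>\<xi>. complex_of_real (heat_remainder k t \<xi>) * G w \<xi>)) \<le> (LINT \<xi>|lborel. \<bar>heat_remainder k t \<xi>\<bar> * W)"
      using gauss_pairing_norm_le[OF _ rG, of \<epsilon> x] \<epsilon> ri
      by (intro order_trans[OF gauss_pairing_norm_le[OF _ rG]] integral_mono' rb order_trans[OF norm_ge_zero rb]) auto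
  qed (use t in auto)
  finally show ?thesis by (simp add: W_def \<Lambda>_def algebra_simps)
qed

section \<open>From Gaussian averages to pointwise bounds\<close>

lemma gauss_kernel_scaled:
  fixes s :: "'a::euclidean_space"
  assumes "0 < \<epsilon>"
  shows "sqrt \<epsilon> ^ DIM('a) * gauss_kernel \<epsilon> (sqrt \<epsilon> *\<^sub>R s) = gauss_kernel 1 s"
  using assms
  by (simp add: gauss_kernel_def power_mult_distrib mult.assoc[symmetric] real_sqrt_mult[symmetric]
      flip: power_mult_distrib) (simp add: power_mult_distrib)

lemma gauss_kernel_le:
  fixes v :: "'a::euclidean_space"
  shows "0 < \<epsilon> \<Longrightarrow> gauss_kernel \<epsilon> v \<le> gauss_kernel \<epsilon> (0 :: 'a)"
  by (simp add: gauss_kernel_def mult_left_le)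

text \<open>Substituting x = y + sqrt(1/(n+1)) s fixes the kernel and moves the parameter into
  \<phi>; continuity then gives the limit and boundedness the domination.\<close>

lemma gauss_mollify:
  fixes \<phi> :: "'a::euclidean_space \<Rightarrow> real"
  assumes cont: "continuous_on UNIV \<phi>" and b: "\<And>x. \<bar>\<phi> x\<bar> \<le> B"
  defines "\<Phi> \<equiv> \<lambda>n y. LINT x|lborel. \<phi> x * gauss_kernel (1 / real (Suc n)) (x - y)"
  shows gauss_mollify_tendsto: "(\<lambda>n. \<Phi> n y) \<longlonglongrightarrow> (2 * pi) ^ DIM('a) * \<phi> y"
    and gauss_mollify_le: "\<bar>\<Phi> n y\<bar> \<le> B * (2 * pi) ^ DIM('a)"
proof -
  have [measurable]: "\<phi> \<in> borel_measurable borel" by (rule borel_measurable_continuous_onI[OF cont])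
  have B: "0 \<le> B" using order_trans[OF abs_ge_zero b] .
  have eq: "\<Phi> n y = (LINT s|lborel. \<phi> (y + sqrt (1 / real (Suc n)) *\<^sub>R s) * gauss_kernel 1 s)" for n y
  proof -
    let ?c = "sqrt (1 / real (Suc n))"
    have "\<Phi> n y = \<bar>?c\<bar> ^ DIM('a) *\<^sub>R (LINT s|lborel. \<phi> (y + ?c *\<^sub>R s) * gauss_kernel (1 / real (Suc n)) (y + ?c *\<^sub>R s - y))"
      unfolding \<Phi>_def by (rule lborel_integral_affine) auto
    also have "\<dots> = (LINT s|lborel. \<phi> (y + ?c *\<^sub>R s) * (?c ^ DIM('a) * gauss_kernel (1 / real (Suc n)) (?c *\<^sub>R s)))"
      by (subst integral_scaleR_right[symmetric]) (simp_all add: mult_ac)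
    finally show ?thesis by (subst (asm) gauss_kernel_scaled) simp_all
  qed
  note G = gauss_kernel_integral[of 1, where 'a = 'a]
  have dom: "integrable lborel (\<lambda>s::'a. B * gauss_kernel 1 s)"
    using G(1) by simp
  have le: "\<bar>\<phi> x * gauss_kernel 1 s\<bar> \<le> B * gauss_kernel 1 s" for x s :: 'a
    unfolding abs_mult using gauss_kernel_nonneg[of 1 s] B by (intro mult_mono b) auto
  have "(\<lambda>n. LINT s|lborel. \<phi> (y + sqrt (1 / real (Suc n)) *\<^sub>R s) * gauss_kernel 1 s) \<longlonglongrightarrow>
      (LINT s|lborel. \<phi> y * gauss_kernel 1 (s::'a))"
  proof (rule integral_dominated_convergence[OF _ _ dom])
    show "AE s in lborel. (\<lambda>n. \<phi> (y + sqrt (1 / real (Suc n)) *\<^sub>R s) * gauss_kernel 1 s) \<longlonglongrightarrow> \<phi> y * gauss_kernel 1 s"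
    proof (rule AE_I2)
      fix s :: 'a
      have "(\<lambda>n. y + sqrt (1 / real (Suc n)) *\<^sub>R s) \<longlonglongrightarrow> y + sqrt 0 *\<^sub>R s"
        by (intro tendsto_intros LIMSEQ_Suc[OF lim_1_over_n])
      then have "(\<lambda>n. \<phi> (y + sqrt (1 / real (Suc n)) *\<^sub>R s)) \<longlonglongrightarrow> \<phi> y"
        using continuous_on_tendsto_compose[OF cont, of _ y] by simp
      then show "(\<lambda>n. \<phi> (y + sqrt (1 / real (Suc n)) *\<^sub>R s) * gauss_kernel 1 s) \<longlonglongrightarrow> \<phi> y * gauss_kernel 1 s"
        by (intro tendsto_intros)
    qed
    show "AE s in lborel. norm (\<phi> (y + sqrt (1 / real (Suc n)) *\<^sub>R s) * gauss_kernel 1 s) \<le> B * gauss_kernel 1 s" for n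
      using le by simp
  qed measurable
  then show "(\<lambda>n. \<Phi> n y) \<longlonglongrightarrow> (2 * pi) ^ DIM('a) * \<phi> y"
    unfolding eq using G(2) by (simp add: mult.commute)
  have "\<bar>\<Phi> n y\<bar> \<le> (LINT s|lborel. \<bar>\<phi> (y + sqrt (1 / real (Suc n)) *\<^sub>R s) * gauss_kernel 1 s\<bar>)"
    unfolding eq by (rule integral_abs_bound)
  also have "\<dots> \<le> (LINT s|lborel. B * gauss_kernel 1 (s::'a))"
    using gauss_kernel_nonneg[of 1, where 'a = 'a] B by (intro integral_mono' dom le) auto
  finally show "\<bar>\<Phi> n y\<bar> \<le> B * (2 * pi) ^ DIM('a)"
    using G(2) by simp
qed

text \<open>Fubini moves the Gaussian average from \<open>v\<close>, where only the averages are
  controlled, to the continuous \<phi>, where it converges pointwise. Since \<phi> is nonnegative,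
  the bound on the averages can be integrated against it.\<close>

lemma integral_test_function_le:
  fixes v \<phi> :: "'a::euclidean_space \<Rightarrow> real"
  assumes v: "integrable lborel v"
    and avg: "\<And>\<epsilon> x. 0 < \<epsilon> \<Longrightarrow> (LINT y|lborel. v y * gauss_kernel \<epsilon> (x - y)) \<le> (2 * pi) ^ DIM('a) * B"
    and cont: "continuous_on UNIV \<phi>" and \<phi>: "integrable lborel \<phi>" "\<And>x. 0 \<le> \<phi> x" "\<And>x. \<phi> x \<le> 1"
  shows "(LINT x|lborel. v x * \<phi> x) \<le> B * (LINT x|lborel. \<phi> x)"
proof -
  have [measurable]: "v \<in> borel_measurable borel" "\<phi> \<in> borel_measurable borel" using v \<phi> by auto
  have \<phi>b: "\<bar>\<phi> x\<bar> \<le> 1" for x using \<phi>(2,3) by simp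
  define \<Phi> where "\<Phi> = (\<lambda>n y. LINT x|lborel. \<phi> x * gauss_kernel (1 / real (Suc n)) (x - y))"
  have le: "(LINT y|lborel. v y * \<Phi> n y) \<le> (2 * pi) ^ DIM('a) * B * (LINT x|lborel. \<phi> x)" for n
  proof -
    define \<epsilon> where "\<epsilon> = 1 / real (Suc n)"
    have \<epsilon>: "0 < \<epsilon>" by (simp add: \<epsilon>_def)
    define c where "c = gauss_kernel \<epsilon> (0 :: 'a)"
    have c: "0 < c" using \<epsilon> by (simp add: c_def gauss_kernel_def)
    \<comment> \<open>Dividing by its maximum \<open>c\<close> brings the kernel into [0, 1]; the
      factor is returned to \<open>v\<close>.\<close>
    have "integrable (lborel \<Otimes>\<^sub>M lborel) (\<lambda>(x, y). \<phi> x * (c * v y) * (\<lambda>(x, y). gauss_kernel \<epsilon> (x - y) / c) (x, y))"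
      using gauss_kernel_nonneg[OF \<epsilon>, where 'a = 'a] gauss_kernel_le[OF \<epsilon>, where 'a = 'a] c v \<phi>(1)
      by (intro integrable_product_bounded sigma_finite_lborel) (auto simp: c_def)
    then have int: "integrable (lborel \<Otimes>\<^sub>M lborel) (\<lambda>(x, y). \<phi> x * (v y * gauss_kernel \<epsilon> (x - y)))"
      using c by (simp add: mult_ac)
    have "(LINT y|lborel. v y * \<Phi> n y) = (LINT y|lborel. (LINT x|lborel. \<phi> x * (v y * gauss_kernel \<epsilon> (x - y))))"
      unfolding \<Phi>_def \<epsilon>_def[symmetric]
      by (intro Bochner_Integration.integral_cong refl, subst integral_mult_right_zero[symmetric])
         (simp add: mult_ac)
    also have "\<dots> = (LINT x|lborel. (LINT y|lborel. \<phi> x * (v y * gauss_kernel \<epsilon> (x - y))))"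
      by (rule lborel_pair.Fubini_integral[OF int])
    also have "\<dots> \<le> (LINT x|lborel. \<phi> x * ((2 * pi) ^ DIM('a) * B))"
    proof (rule integral_mono)
      show "integrable lborel (\<lambda>x. LINT y|lborel. \<phi> x * (v y * gauss_kernel \<epsilon> (x - y)))"
        by (rule lborel_pair.integrable_fst[OF int])
      show "(LINT y|lborel. \<phi> x * (v y * gauss_kernel \<epsilon> (x - y))) \<le> \<phi> x * ((2 * pi) ^ DIM('a) * B)" for x
        unfolding integral_mult_right_zero by (intro mult_left_mono avg \<epsilon> \<phi>)
    qed (use \<phi> in simp)
    finally show ?thesis by (simp add: mult_ac)
  qed
  have "(\<lambda>n. LINT y|lborel. v y * \<Phi> n y) \<longlonglongrightarrow> (LINT y|lborel. v y * ((2 * pi) ^ DIM('a) * \<phi> y))"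
  proof (rule integral_dominated_convergence)
    show "integrable lborel (\<lambda>y. \<bar>v y\<bar> * (2 * pi) ^ DIM('a))"
      using v by simp
    show "AE y in lborel. (\<lambda>n. v y * \<Phi> n y) \<longlonglongrightarrow> v y * ((2 * pi) ^ DIM('a) * \<phi> y)"
      unfolding \<Phi>_def using gauss_mollify_tendsto[OF cont \<phi>b] by (intro AE_I2 tendsto_intros)
    show "AE y in lborel. norm (v y * \<Phi> n y) \<le> \<bar>v y\<bar> * (2 * pi) ^ DIM('a)" for n
      unfolding \<Phi>_def using gauss_mollify_le[OF cont \<phi>b]
      by (intro AE_I2) (simp add: abs_mult mult_left_mono)
    show "(\<lambda>y. v y * \<Phi> n y) \<in> borel_measurable lborel" for n
      unfolding \<Phi>_def by measurable
  qed measurable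
  then have "(LINT y|lborel. v y * ((2 * pi) ^ DIM('a) * \<phi> y)) \<le> (2 * pi) ^ DIM('a) * B * (LINT x|lborel. \<phi> x)"
    by (rule LIMSEQ_le_const2) (use le in auto)
  moreover have "(LINT y|lborel. v y * ((2 * pi) ^ DIM('a) * \<phi> y)) = (2 * pi) ^ DIM('a) * (LINT y|lborel. v y * \<phi> y)"
    by (subst integral_mult_right_zero[symmetric]) (simp add: mult_ac)
  ultimately have "(2 * pi) ^ DIM('a) * (LINT y|lborel. v y * \<phi> y) \<le> (2 * pi) ^ DIM('a) * (B * (LINT x|lborel. \<phi> x))"
    by (simp add: mult.assoc)
  then show ?thesis by (simp add: mult_le_cancel_left_pos)
qed

lemma integral_compact_le:
  fixes v :: "'a::euclidean_space \<Rightarrow> real"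
  assumes v: "integrable lborel v"
    and avg: "\<And>\<epsilon> x. 0 < \<epsilon> \<Longrightarrow> (LINT y|lborel. v y * gauss_kernel \<epsilon> (x - y)) \<le> (2 * pi) ^ DIM('a) * B"
    and K: "compact K" "K \<noteq> {}"
  shows "(LINT x|lborel. v x * indicator K x) \<le> B * measure lborel K"
proof -
  \<comment> \<open>Tents equal to 1 on \<open>K\<close> and 0 at distance 1/(n+1) or more. The set
    must be nonempty here: \<open>infdist\<close> to the empty set is 0, and the tents would be
    constantly 1.\<close>
  define \<phi> where "\<phi> n x = max 0 (1 - real (Suc n) * infdist x K)" for n x
  have cl: "closed K" and bd: "bounded K" using K compact_eq_bounded_closed by auto
  obtain r where r: "\<And>x. x \<in> K \<Longrightarrow> norm x \<le> r" using bd by (auto simp: bounded_iff)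
  have [measurable]: "K \<in> sets borel" using cl by auto
  have [measurable]: "v \<in> borel_measurable borel" using v by auto
  have cont: "continuous_on UNIV (\<phi> n)" for n
    unfolding \<phi>_def by (intro continuous_intros)
  then have [measurable]: "\<phi> n \<in> borel_measurable borel" for n by (rule borel_measurable_continuous_onI)
  have \<phi>01: "0 \<le> \<phi> n x" "\<phi> n x \<le> 1" for n x
    using infdist_nonneg[of x K] by (auto simp: \<phi>_def)
  \<comment> \<open>Outside this ball the distance to \<open>K\<close> is at least 1, so one ball
    carries all tents and its indicator dominates them.\<close>
  have supp: "\<phi> n x \<le> indicator (cball 0 (r + 1)) x" for n x
  proof (cases "x \<in> cball 0 (r + 1)")
    case False
    obtain y where y: "y \<in> K" "infdist x K = dist x y" using infdist_attains_inf[OF cl K(2)] by blast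
    have "norm x \<le> norm y + dist x y" by (metis dist_norm norm_triangle_sub)
    then have "1 \<le> infdist x K" using False r[OF y(1)] y(2) by simp
    then have "1 \<le> real (Suc n) * infdist x K" using mult_mono[of 1 "real (Suc n)" 1 "infdist x K"] by simp
    then show ?thesis by (simp add: \<phi>_def)
  qed (use \<phi>01 in simp)
  have cb: "integrable lborel (indicator (cball 0 (r + 1)) :: 'a \<Rightarrow> real)"
    by (simp add: integrable_indicator_iff emeasure_bounded_finite[unfolded infinity_ennreal_def])
  have \<phi>i: "integrable lborel (\<phi> n)" for n
    by (rule Bochner_Integration.integrable_bound[OF cb]) (use \<phi>01 supp in auto)
  have lim: "(\<lambda>n. \<phi> n x) \<longlonglongrightarrow> indicator K x" for x
  proof (cases "x \<in> K")
    case True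
    then show ?thesis by (simp add: \<phi>_def)
  next
    case False
    then have pos: "0 < infdist x K"
      using in_closed_iff_infdist_zero[OF cl K(2)] infdist_nonneg[of x K] by (metis less_eq_real_def)
    have "\<forall>\<^sub>F n in sequentially. 1 / infdist x K \<le> real n"
      using eventually_ge_at_top[of "nat \<lceil>1 / infdist x K\<rceil>"] by eventually_elim (simp add: nat_le_iff ceiling_le_iff)
    then have "\<forall>\<^sub>F n in sequentially. \<phi> n x = indicator K x"
    proof eventually_elim
      case (elim n)
      then have "1 \<le> real n * infdist x K" using pos by (simp add: divide_le_eq)
      also have "\<dots> \<le> real (Suc n) * infdist x K" using pos by (intro mult_right_mono) auto
      finally show ?case using False by (simp add: \<phi>_def)
    qed
    then show ?thesis by (rule tendsto_eventually)
  qed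
  have "(\<lambda>n. LINT x|lborel. v x * \<phi> n x) \<longlonglongrightarrow> (LINT x|lborel. v x * indicator K x)"
  proof (rule integral_dominated_convergence)
    show "integrable lborel (\<lambda>x. \<bar>v x\<bar>)" using v by simp
    show "AE x in lborel. norm (v x * \<phi> n x) \<le> \<bar>v x\<bar>" for n
      using \<phi>01 by (intro AE_I2) (simp add: abs_mult mult_left_le)
    show "AE x in lborel. (\<lambda>n. v x * \<phi> n x) \<longlonglongrightarrow> v x * indicator K x"
      by (intro AE_I2 tendsto_intros lim)
  qed measurable
  moreover have "(\<lambda>n. LINT x|lborel. \<phi> n x) \<longlonglongrightarrow> (LINT x|lborel. indicator K x)"
    by (rule integral_dominated_convergence[OF _ _ cb]) (use lim \<phi>01 supp in auto)
  then have "(\<lambda>n. B * (LINT x|lborel. \<phi> n x)) \<longlonglongrightarrow> B * measure lborel K"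
    by (intro tendsto_intros) simp
  ultimately show ?thesis
    by (rule LIMSEQ_le) (use integral_test_function_le[OF v avg cont \<phi>i \<phi>01] in auto)
qed

text \<open>If \<open>v > B\<close> on a set of positive measure, inner regularity gives a compact
  subset of positive measure, on which the integral of \<open>v - B\<close> would be both positive
  and at most 0.\<close>

lemma AE_le_of_gauss_average:
  fixes v :: "'a::euclidean_space \<Rightarrow> real"
  assumes v: "integrable lborel v"
    and avg: "\<And>\<epsilon> x. 0 < \<epsilon> \<Longrightarrow> (LINT y|lborel. v y * gauss_kernel \<epsilon> (x - y)) \<le> (2 * pi) ^ DIM('a) * B"
  shows "AE x in lborel. v x \<le> B"
proof -
  have [measurable]: "v \<in> borel_measurable borel" using v by auto
  \<comment> \<open>Restriction to balls makes the measure finite and the closed subsets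
    compact.\<close>
  define S where "S n = {x \<in> cball 0 (real n). B < v x}" for n :: nat
  have S [measurable]: "S n \<in> sets borel" for n unfolding S_def by measurable
  have "S n \<in> null_sets lborel" for n
  proof (rule ccontr)
    assume "S n \<notin> null_sets lborel"
    then have pos: "0 < emeasure lborel (S n)" by (auto simp: null_sets_def zero_less_iff_neq_zero)
    have fin: "emeasure lborel (S n) < \<infinity>"
      by (rule le_less_trans[OF emeasure_mono[of _ "cball 0 (real n)"]])
         (auto simp: S_def emeasure_bounded_finite[unfolded infinity_ennreal_def])
    define e where "e = measure lborel (S n)"
    have e2: "emeasure lborel (S n) = ennreal e"
      unfolding e_def using fin by (intro emeasure_eq_ennreal_measure) simp
    with pos have e: "0 < e" by simp
    have "S n \<in> sets lebesgue" using S by simp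
    \<comment> \<open>The part left out has measure less than that of \<open>S n\<close>, so
      \<open>T\<close> cannot be null.\<close>
    then obtain T where T: "closed T" "T \<subseteq> S n" and Te: "emeasure lebesgue (S n - T) < ennreal e"
      by (rule sets_lebesgue_inner_closed[OF _ e]) blast
    have [measurable]: "T \<in> sets borel" using T by auto
    have "bounded T"
      by (rule bounded_subset[OF bounded_cball[of 0 "real n"]]) (use T in \<open>auto simp: S_def\<close>)
    then have cT: "compact T" using T by (simp add: compact_eq_bounded_closed)
    have Tpos: "emeasure lborel T \<noteq> 0"
    proof
      assume "emeasure lborel T = 0"
      then have "emeasure lborel (S n - T) = emeasure lborel (S n)"
        by (intro emeasure_Diff_null_set) (auto simp: null_sets_def)
      then show False using Te e2 by simp
    qed
    have Tfin: "emeasure lborel T < \<infinity>"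
      using emeasure_mono[OF T(2), of lborel] fin by (simp add: le_less_trans)
    have i: "integrable lborel (\<lambda>x. v x * indicator T x)"
      using integrable_real_mult_indicator[OF _ v, of T] by simp
    have j: "integrable lborel (\<lambda>x. B * indicator T x)"
      using Tfin by (intro integrable_mult_right) (simp add: integrable_indicator_iff)
    have "T \<noteq> {}" using Tpos by auto
    from integral_compact_le[OF v avg cT this]
    have "(LINT x|lborel. v x * indicator T x - B * indicator T x) \<le> 0"
      using i j by simp
    moreover have nn: "0 \<le> v x * indicator T x - B * indicator T x" for x
      using T(2) by (auto simp: S_def indicator_def)
    ultimately have "(LINT x|lborel. v x * indicator T x - B * indicator T x) = 0"
      by (intro antisym Bochner_Integration.integral_nonneg)
    then have "AE x in lborel. v x * indicator T x - B * indicator T x = 0"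
      using i j nn by (subst (asm) integral_nonneg_eq_0_iff_AE) auto
    then have "AE x in lborel. x \<notin> T"
      by eventually_elim (use T(2) in \<open>auto simp: S_def\<close>)
    then show False using Tpos AE_iff_null_sets[of T lborel] by (auto simp: null_sets_def)
  qed
  then have "AE x in lborel. \<forall>n. x \<notin> S n"
    by (subst AE_all_countable) (auto dest: AE_not_in)
  then show ?thesis
  proof eventually_elim
    case (elim x)
    then show ?case using real_arch_simple[of "norm x"] by (auto simp: S_def not_less)
  qed
qed

lemma AE_abs_le_of_gauss_average:
  fixes v :: "'a::euclidean_space \<Rightarrow> real"
  assumes v: "integrable lborel v"
    and avg: "\<And>\<epsilon> x. 0 < \<epsilon> \<Longrightarrow> \<bar>LINT y|lborel. v y * gauss_kernel \<epsilon> (x - y)\<bar> \<le> (2 * pi) ^ DIM('a) * B"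
  shows "AE x in lborel. \<bar>v x\<bar> \<le> B"
proof -
  have "AE x in lborel. v x \<le> B"
    using avg by (intro AE_le_of_gauss_average[OF v]) (simp add: abs_le_iff)
  moreover have "AE x in lborel. - v x \<le> B"
    using avg v by (intro AE_le_of_gauss_average) (simp_all add: abs_le_iff)
  ultimately show ?thesis by eventually_elim simp
qed

section \<open>Reduction to Borel data\<close>

text \<open>Preimages under \<open>f\<close> and \<open>g\<close> differ by a null set, which the
  completion absorbs. It provides the measurability that \<open>integral_cong_AE\<close> asks of a
  function known only up to null sets.\<close>

lemma measurable_completion_AE_eq:
  fixes f g :: "'a \<Rightarrow> 'b::topological_space"
  assumes g: "g \<in> borel_measurable M" and ae: "AE x in M. f x = g x"
  shows "f \<in> borel_measurable (completion M)"
proof -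
  show ?thesis
  proof (rule measurableI)
    fix A :: "'b set"
    assume "A \<in> sets borel"
    then have A: "g -` A \<inter> space M \<in> sets (completion M)"
      using measurable_sets[OF measurable_completion[OF g]] by simp
    have eq: "AE x in completion M. x \<in> g -` A \<inter> space M \<longleftrightarrow> x \<in> f -` A \<inter> space (completion M)"
      by (rule eventually_mono[OF AE_completion[OF ae]]) auto
    show "f -` A \<inter> space (completion M) \<in> sets (completion M)"
      by (rule completion.in_sets_AE[OF eq A]) simp
  qed simp
qed

text \<open>\<mu> may be singular, so a Lebesgue-null set need not be \<mu>-null. But for each fixed
  \<open>y\<close> the translate is harmless for almost every \<open>x\<close>, and Fubini exchanges
  the two quantifiers.\<close>

lemma convolution_measure_AE_eq:
  fixes f g :: "'a::euclidean_space \<Rightarrow> real"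
  assumes \<mu>: "finite_measure \<mu>" "sets \<mu> = sets borel"
    and [measurable]: "g \<in> borel_measurable borel" and ae: "AE x in lborel. f x = g x"
  shows "AE x in lborel. convolution_measure f \<mu> x = convolve \<mu> g x"
proof -
  interpret finite_measure \<mu> by fact
  interpret pair_sigma_finite \<mu> "lborel :: 'a measure" ..
  note \<mu>(2) [measurable_cong]
  \<comment> \<open>A Borel null superset of the set of disagreement gives the exchange of
    quantifiers a measurable predicate.\<close>
  obtain N where N: "{x \<in> space lborel. f x \<noteq> g x} \<subseteq> N" "emeasure lborel N = 0" "N \<in> sets lborel"
    by (rule AE_E[OF ae])
  then have [measurable]: "N \<in> sets borel" and fN: "\<And>x. x \<notin> N \<Longrightarrow> f x = g x" by auto
  have "AE x in lborel. x \<notin> N" using N by (intro AE_not_in) (simp add: null_sets_def)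
  then have "AE x in lborel. x - y \<notin> N" for y
    using lborel_AE_affine[of "\<lambda>x. x \<notin> N" 1 "- y"] by simp
  then have "AE y in \<mu>. AE x in lborel. x - y \<notin> N" by simp
  then have "AE x in lborel. AE y in \<mu>. x - y \<notin> N"
    by (subst (asm) AE_commute) measurable
  then show ?thesis
  proof eventually_elim
    case (elim x)
    then have eq: "AE y in \<mu>. f (x - y) = g (x - y)" by eventually_elim (rule fN)
    have m: "(\<lambda>y. g (x - y)) \<in> borel_measurable \<mu>" by measurable
    have "convolution_measure f \<mu> x = (LINT y|completion \<mu>. g (x - y))"
      unfolding convolution_measure_def
      by (intro integral_cong_AE measurable_completion_AE_eq[OF m eq] measurable_completion[OF m] AE_completion eq)
    also have "\<dots> = convolve \<mu> g x"
      unfolding convolve_def by (rule integral_completion[OF m])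
    finally show ?case .
  qed
qed

section \<open>Splitting the kernel into an annulus part and a rest\<close>

lemma integrable_one_minus_cos_mult:
  fixes K :: "'a::euclidean_space \<Rightarrow> real"
  assumes [measurable]: "K \<in> borel_measurable borel" and K: "integrable lborel (\<lambda>z. K z * min ((norm z)\<^sup>2) 1)"
  shows "integrable lborel (\<lambda>z. (1 - cos (z \<bullet> \<xi>)) * K z)"
proof (rule Bochner_Integration.integrable_bound)
  show "integrable lborel (\<lambda>z. (2 + (norm \<xi>)\<^sup>2) * (K z * min ((norm z)\<^sup>2) 1))"
    by (intro integrable_mult_right K)
  have "\<bar>(1 - cos (z \<bullet> \<xi>)) * K z\<bar> \<le> \<bar>(2 + (norm \<xi>)\<^sup>2) * (K z * min ((norm z)\<^sup>2) 1)\<bar>" for z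
    using mult_right_mono[OF one_minus_cos_le_min[of z \<xi>], of "\<bar>K z\<bar>"]
    by (simp add: abs_mult mult_ac)
  then show "AE z in lborel. norm ((1 - cos (z \<bullet> \<xi>)) * K z) \<le> norm ((2 + (norm \<xi>)\<^sup>2) * (K z * min ((norm z)\<^sup>2) 1))"
    by simp
qed measurable

lemma annulus_kernel:
  fixes r c :: real
  defines "k \<equiv> (\<lambda>z::'a::euclidean_space. c * indicator {z. r \<le> norm z \<and> norm z \<le> 2 * r} z)"
  assumes "0 < r" "0 < c"
  shows "integrable lborel k" "0 < integral\<^sup>L lborel k"
proof -
  let ?A = "{z::'a. r \<le> norm z \<and> norm z \<le> 2 * r}"
  have fin: "emeasure lborel ?A < \<infinity>"
    by (intro emeasure_bounded_finite boundedI[of _ "2 * r"]) auto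
  show i: "integrable lborel k"
    unfolding k_def using fin by (intro integrable_mult_right) (auto simp: integrable_indicator_iff)
  obtain e :: 'a where e: "norm e = 1" using vector_choose_size[of 1] by auto
  \<comment> \<open>Centre at mid-shell, radius half the width of the shell.\<close>
  have sub: "ball ((3 * r / 2) *\<^sub>R e) (r / 2) \<subseteq> ?A"
  proof
    fix z assume "z \<in> ball ((3 * r / 2) *\<^sub>R e) (r / 2)"
    then have "norm ((3 * r / 2) *\<^sub>R e - z) < r / 2" by (simp add: dist_norm)
    moreover have "norm ((3 * r / 2) *\<^sub>R e) = 3 * r / 2" using e assms by simp
    ultimately show "z \<in> ?A"
      using norm_triangle_ineq2[of "(3 * r / 2) *\<^sub>R e" z] norm_triangle_ineq3[of "(3 * r / 2) *\<^sub>R e" z] by auto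
  qed
  have "0 < measure lborel (ball ((3 * r / 2) *\<^sub>R e) (r / 2))"
    using content_ball_pos[of "r / 2" "(3 * r / 2) *\<^sub>R e"] assms by simp
  also have "\<dots> \<le> measure lborel ?A"
    using sub fin by (intro measure_mono_fmeasurable) (auto simp: fmeasurable_def)
  finally show "0 < integral\<^sup>L lborel k"
    using assms by (simp add: k_def)
qed

text \<open>\<open>J\<close> is controlled only off the origin and up to Lebesgue measurability,
  while the estimates want \<open>K\<close> Borel, even and nonnegative at every point. Each repair
  either acts on a null set or, like symmetrising, is invisible to the even factor 1 - cos.\<close>

lemma levy_kernel_decomposition:
  fixes J k :: "'a::euclidean_space \<Rightarrow> real"
  assumes J: "integrable lebesgue (\<lambda>z. J z * min ((norm z)\<^sup>2) 1)"
    and k: "integrable lborel k" "\<And>z. 0 \<le> k z" "\<And>z. k (- z) = k z" and kJ: "\<And>z. z \<noteq> 0 \<Longrightarrow> k z \<le> J z"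
  obtains K where "K \<in> borel_measurable borel" "\<And>z. 0 \<le> K z" "\<And>z. K (- z) = K z"
    "integrable lborel (\<lambda>z. K z * min ((norm z)\<^sup>2) 1)"
    "\<And>\<xi>. multiplier J \<xi> = levy_symbol k \<xi> + levy_symbol K \<xi>"
proof -
  let ?m = "\<lambda>z::'a. min ((norm z)\<^sup>2) 1"
  have [measurable]: "k \<in> borel_measurable borel" using k by auto
  obtain g where g [measurable]: "g \<in> borel_measurable lborel" and Jg: "AE z in lborel. J z * ?m z = g z"
    using completion_ex_borel_measurable_real[OF borel_measurable_integrable[OF J]] by auto
  \<comment> \<open>The weight vanishes only at 0, so dividing recovers \<open>J\<close> almost
    everywhere; at 0 division by zero gives 0.\<close>
  define J' where "J' z = g z / ?m z" for z
  have [measurable]: "J' \<in> borel_measurable borel" unfolding J'_def using g by measurable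
  have nz: "AE z in lborel. z \<noteq> (0::'a)" by (rule AE_lborel_singleton)
  have JJ': "AE z in lborel. J z = J' z"
    using Jg nz by eventually_elim (simp add: J'_def field_simps min_def split: if_splits)
  have "integrable lebesgue g"
    using J integrable_cong_AE[of "\<lambda>z. J z * ?m z" lebesgue g] AE_completion[OF Jg] g
    by (simp add: borel_measurable_integrable[OF J] measurable_completion)
  then have "integrable lborel g" by (simp add: integrable_completion)
  moreover have "AE z in lborel. g z = J' z * ?m z"
    using nz by eventually_elim (auto simp: J'_def min_def)
  ultimately have J'i: "integrable lborel (\<lambda>z. J' z * ?m z)"
    using integrable_cong_AE[of g lborel "\<lambda>z. J' z * ?m z"] by simp
  \<comment> \<open>A representative chosen almost everywhere need not be even, so it is averaged
    with its reflection.\<close>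
  define Jo where "Jo z = (J' z + J' (- z)) / 2" for z
  have [measurable]: "Jo \<in> borel_measurable borel" unfolding Jo_def by measurable
  \<comment> \<open>The bound by \<open>k\<close> holds only almost everywhere; \<open>max\<close>
    enforces nonnegativity at the exceptional points.\<close>
  define K where "K z = max 0 (Jo z - k z)" for z
  have Km [measurable]: "K \<in> borel_measurable borel" unfolding K_def by measurable
  have Knn: "0 \<le> K z" and Keven: "K (- z) = K z" for z
    using k(3) by (simp_all add: K_def Jo_def add.commute)
  have Ki: "integrable lborel (\<lambda>z. K z * ?m z)"
  proof (rule Bochner_Integration.integrable_bound)
    show "integrable lborel (\<lambda>z. \<bar>J' z * ?m z\<bar> + \<bar>J' (- z) * ?m (- z)\<bar>)"
      using J'i lborel_integrable_reflect_iff[of "\<lambda>z. J' z * ?m z"]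
      by (intro Bochner_Integration.integrable_add integrable_abs) auto
    have "Jo z \<le> \<bar>J' z\<bar> + \<bar>J' (- z)\<bar>" for z
      by (simp add: Jo_def abs_if)
    then have "K z \<le> \<bar>J' z\<bar> + \<bar>J' (- z)\<bar>" for z
      using k(2)[of z] by (simp add: K_def add_increasing2 diff_le_eq)
    then have "K z * ?m z \<le> (\<bar>J' z\<bar> + \<bar>J' (- z)\<bar>) * ?m z" for z
      by (rule mult_right_mono) simp
    then show "AE z in lborel. norm (K z * ?m z) \<le> norm (\<bar>J' z * ?m z\<bar> + \<bar>J' (- z) * ?m (- z)\<bar>)"
      using Knn by (intro AE_I2) (simp add: abs_mult distrib_right)
  qed measurable
  have "AE z in lborel. J (- z) = J' (- z)"
    using lborel_AE_affine[OF JJ', of "-1" 0] by simp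
  then have JoK: "AE z in lborel. Jo z = k z + K z"
    using JJ' nz
  proof eventually_elim
    case (elim z)
    then have "k z \<le> Jo z"
      using kJ[of z] kJ[of "- z"] k(3)[of z] by (simp add: Jo_def)
    then show ?case by (simp add: K_def)
  qed
  have "multiplier J \<xi> = levy_symbol k \<xi> + levy_symbol K \<xi>" for \<xi>
  proof -
    let ?c = "\<lambda>z. 1 - cos (z \<bullet> \<xi>)"
    have m: "(\<lambda>z. ?c z * J' z) \<in> borel_measurable lborel" by measurable
    have ae: "AE z in lborel. ?c z * J z = ?c z * J' z" using JJ' by eventually_elim simp
    have "multiplier J \<xi> = (LINT z|lebesgue. ?c z * J' z)"
      unfolding multiplier_def
      by (intro integral_cong_AE measurable_completion_AE_eq[OF m ae] measurable_completion[OF m] AE_completion ae)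
    also have "\<dots> = (LINT z|lborel. ?c z * J' z)" by (rule integral_completion[OF m])
    also have "\<dots> = (LINT z|lborel. (?c z * J' z + ?c (- z) * J' (- z)) / 2)"
      using integrable_one_minus_cos_mult[OF _ J'i, of \<xi>] lborel_integral_reflect[of "\<lambda>z. ?c z * J' z"]
        lborel_integrable_reflect_iff[of "\<lambda>z. ?c z * J' z"]
      by simp
    also have "\<dots> = (LINT z|lborel. ?c z * Jo z)"
      by (simp add: Jo_def distrib_left)
    also have "\<dots> = (LINT z|lborel. ?c z * k z + ?c z * K z)"
      using JoK by (intro integral_cong_AE) (auto simp: distrib_left elim!: eventually_mono)
    also have "\<dots> = levy_symbol k \<xi> + levy_symbol K \<xi>"
      unfolding levy_symbol_def
      using Bochner_Integration.integrable_diff[OF k(1) integrable_cos_mult(1)[OF k(1), of \<xi>]]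
        integrable_one_minus_cos_mult[OF Km Ki, of \<xi>]
      by (intro Bochner_Integration.integral_add) (auto simp: left_diff_distrib)
    finally show ?thesis .
  qed
  with that[OF Km Knn Keven Ki] show ?thesis by blast
qed

lemma bounded_borel_representative:
  fixes f :: "'a::euclidean_space \<Rightarrow> real"
  assumes f: "integrable lebesgue f" and fin: "Linf_norm f < \<infinity>"
  obtains w M where "integrable lborel w" "\<And>x. \<bar>w x\<bar> \<le> M" "AE x in lborel. f x = w x"
proof -
  obtain g where g [measurable]: "g \<in> borel_measurable lborel" and fg: "AE x in lborel. f x = g x"
    using completion_ex_borel_measurable_real[OF borel_measurable_integrable[OF f]] by auto
  define M where "M = max 0 (real_of_ereal (Linf_norm f))"
  have "AE x in lebesgue. ereal \<bar>f x\<bar> \<le> Linf_norm f"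
    unfolding Linf_norm_def by (rule esssup_AE)
  then have fM: "AE x in lborel. \<bar>f x\<bar> \<le> M"
    unfolding AE_completion_iff
    by eventually_elim (use fin in \<open>cases "Linf_norm f"; auto simp: M_def\<close>)
  \<comment> \<open>Clamping to [-M, M] changes nothing almost everywhere and turns the essential
    bound into the pointwise one that the sup estimates use.\<close>
  define w where "w x = max (- M) (min M (g x))" for x
  have [measurable]: "w \<in> borel_measurable lborel" unfolding w_def using g by measurable
  have wM: "\<bar>w x\<bar> \<le> M" for x by (auto simp: w_def M_def)
  have fw: "AE x in lborel. f x = w x"
    using fg fM by eventually_elim (auto simp: w_def)
  have "integrable lebesgue w"
    using f integrable_cong_AE[of f lebesgue w] AE_completion[OF fw]
    by (simp add: borel_measurable_integrable[OF f] measurable_completion)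
  then have "integrable lborel w" by (simp add: integrable_completion)
  from that[OF this wM fw] show ?thesis .
qed

theorem theorem4p9:
  fixes J :: "'a::euclidean_space \<Rightarrow> real"
    and u0 :: "'a \<Rightarrow> real"
    and u :: "real \<Rightarrow> 'a \<Rightarrow> real"
    and \<alpha> c0 R :: real
  assumes "levy_kernel J"
    and "0 < \<alpha>" and "\<alpha> \<le> 2" and "0 < c0" and "0 < R"
    and "\<And>z. norm z \<ge> R \<Longrightarrow> J z \<ge> c0 * norm z powr (- real DIM('a) - \<alpha>)"
    and "integrable lebesgue u0" and "Linf_norm u0 < \<infinity>"
    and "nonlocal_heat_solution J u0 u"
  shows "((\<lambda>t. Linf_norm (u t)) \<longlongrightarrow> 0) at_top"
proof -
  \<comment> \<open>The tail bound decreases in |z|, so on R \<le> |z| \<le> 2R it is smallest at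
    2R; that value is \<open>c\<close>.\<close>
  define c where "c = c0 * (2 * R) powr (- real DIM('a) - \<alpha>)"
  define k where "k = (\<lambda>z::'a. c * indicator {z. R \<le> norm z \<and> norm z \<le> 2 * R} z)"
  have c: "0 < c" using assms(4,5) by (simp add: c_def)
  have k: "integrable lborel k" "\<And>z. 0 \<le> k z" "\<And>z. k z \<le> c" "\<And>z. k (- z) = k z" "0 < integral\<^sup>L lborel k"
    using annulus_kernel[OF assms(5) c, where 'a = 'a] c by (auto simp: k_def indicator_def)
  have kJ: "k z \<le> J z" if "z \<noteq> 0" for z
  proof (cases "R \<le> norm z \<and> norm z \<le> 2 * R")
    case True
    then have "c \<le> c0 * norm z powr (- real DIM('a) - \<alpha>)"
      unfolding c_def using assms(2,4,5) by (intro mult_left_mono powr_mono2') auto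
    then show ?thesis using assms(6)[of z] True by (simp add: k_def)
  next
    case False
    then show ?thesis using assms(1) that by (auto simp: k_def levy_kernel_def)
  qed
  have "integrable lebesgue (\<lambda>z. J z * min ((norm z)\<^sup>2) 1)"
    using assms(1) by (simp add: levy_kernel_def)
  then obtain K where K: "K \<in> borel_measurable borel" "\<And>z. 0 \<le> K z" "\<And>z. K (- z) = K z"
      "integrable lborel (\<lambda>z. K z * min ((norm z)\<^sup>2) 1)"
    and mult: "\<And>\<xi>. multiplier J \<xi> = levy_symbol k \<xi> + levy_symbol K \<xi>"
    using levy_kernel_decomposition[of J k] k(1,2,4) kJ by blast
  obtain w M where w: "integrable lborel w" "\<And>x. \<bar>w x\<bar> \<le> M" and u0w: "AE x in lborel. u0 x = w x"
    using bounded_borel_representative[OF assms(7,8)] by blast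
  obtain \<mu> where \<mu>: "\<And>t. 0 \<le> t \<Longrightarrow> heat_measure J t (\<mu> t)" "\<And>t. 0 \<le> t \<Longrightarrow> u t \<in> borel_measurable lebesgue"
    "\<And>t. 0 \<le> t \<Longrightarrow> AE x in lebesgue. u t x = convolution_measure u0 (\<mu> t) x"
    using assms(9) unfolding nonlocal_heat_solution_def by blast
  define \<Lambda> where "\<Lambda> = integral\<^sup>L lborel k"
  \<comment> \<open>The bound of \<open>gauss_pairing_heat\<close> divided by
    \<open>(2 * pi) ^ DIM('a)\<close>, the mass of the averaging kernel.\<close>
  define B where "B t = ((LINT y|lborel. \<bar>w y\<bar>) * (LINT \<xi>|lborel. \<bar>heat_remainder k t \<xi>\<bar>)) / (2 * pi) ^ DIM('a)
    + M * (exp (- t * \<Lambda>) * (1 + t * \<Lambda>))" for t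
  have le: "Linf_norm (u t) \<le> ereal (B t)" if t: "0 \<le> t" for t
  proof -
    define v where "v = convolve (\<mu> t) w"
    have \<mu>t: "finite_measure (\<mu> t)" "sets (\<mu> t) = sets borel"
      using \<mu>(1)[OF t] by (auto simp: heat_measure_def prob_space_def)
    have v: "integrable lborel v"
      unfolding v_def by (rule integrable_convolve[OF \<mu>t w(1)])
    \<comment> \<open>In the estimate of the Gaussian averages \<mu> t enters only through its
      transform, where the split symbol can be inserted.\<close>
    have Fv: "fourier v = (\<lambda>\<xi>. exp (- t * (levy_symbol k \<xi> + levy_symbol K \<xi>)) * fourier w \<xi>)"
      using \<mu>(1)[OF t] unfolding v_def
      by (auto simp: fun_eq_iff fourier_convolve[OF \<mu>t w(1)] heat_measure_def mult algebra_simps)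
    have "AE x in lborel. \<bar>v x\<bar> \<le> B t"
    proof (rule AE_abs_le_of_gauss_average[OF v])
      fix \<epsilon> :: real and x :: 'a
      assume \<epsilon>: "0 < \<epsilon>"
      have "\<bar>LINT y|lborel. v y * gauss_kernel \<epsilon> (x - y)\<bar> = norm (gauss_pairing \<epsilon> x (fourier v))"
        by (simp add: gauss_pairing_fourier[OF \<epsilon> v])
      also have "\<dots> \<le> (2 * pi) ^ DIM('a) * B t"
        unfolding Fv using gauss_pairing_heat[OF \<epsilon> w t k K, of x]
        by (simp add: B_def \<Lambda>_def distrib_left mult_ac)
      finally show "\<bar>LINT y|lborel. v y * gauss_kernel \<epsilon> (x - y)\<bar> \<le> (2 * pi) ^ DIM('a) * B t" .
    qed
    moreover have "AE x in lborel. u t x = convolution_measure u0 (\<mu> t) x"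
      using \<mu>(3)[OF t] by (simp add: AE_completion_iff)
    moreover have "AE x in lborel. convolution_measure u0 (\<mu> t) x = v x"
      unfolding v_def using w(1) by (intro convolution_measure_AE_eq \<mu>t u0w) auto
    ultimately have "AE x in lborel. ereal \<bar>u t x\<bar> \<le> ereal (B t)"
      by eventually_elim simp
    then show ?thesis
      unfolding Linf_norm_def using \<mu>(2)[OF t] by (intro esssup_I AE_completion) auto
  qed
  have upper: "\<forall>\<^sub>F t in at_top. Linf_norm (u t) \<le> ereal (B t)"
    using eventually_ge_at_top[of 0] by eventually_elim (rule le)
  \<comment> \<open>For negative t nothing is known about \<open>u t\<close>, not even
    measurability; \<open>esssup\<close> of a non-measurable function is the top value, so the lower
    bound holds in that case too.\<close>
  have "0 \<le> Linf_norm (u t)" for t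
  proof (cases "(\<lambda>x. ereal \<bar>u t x\<bar>) \<in> borel_measurable lebesgue")
    case True
    have "esssup lebesgue (\<lambda>x::'a. 0 :: ereal) \<le> Linf_norm (u t)"
      unfolding Linf_norm_def by (intro esssup_mono) auto
    then show ?thesis by (simp add: esssup_const)
  qed (simp add: Linf_norm_def esssup_non_measurable)
  moreover have "(B \<longlongrightarrow> ((LINT y|lborel. \<bar>w y\<bar>) * 0) / (2 * pi) ^ DIM('a) + M * 0) at_top"
    unfolding B_def[abs_def] using k(5)
    by (intro tendsto_intros heat_remainder_tendsto[OF k] exp_decay_tendsto) (auto simp: \<Lambda>_def)
  then have "((\<lambda>t. ereal (B t)) \<longlongrightarrow> 0) at_top"
    by (simp add: zero_ereal_def)
  ultimately show ?thesis
    by (intro tendsto_sandwich[OF _ upper tendsto_const]) auto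
qed

end
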